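(* Let $n,p$ be positive integers with $p\le n$, let $A\in\mathbb{R}^{2n\times 2n}$ be symmetric positive definite, let $\beta>0$, and let $$f_\beta(X)=\tfrac12\operatorname{tr}(X^\top AX)+\tfrac{\beta}{4}\|X^\top J_nX-J_p\|_F^2,\qquad X\in\mathbb{R}^{2n\times 2p}.$$ A matrix $X\in\mathbb{R}^{2n\times 2p}$ satisfies $\nabla f_\beta(X)=0$ if and only if it admits a decomposition $$X=\left[\hat S_1(I_q-\hat D/\beta)^{1/2}\;\; 0_{2n\times(p-q)}\;\; \hat S_2(I_q-\hat D/\beta)^{1/2}\;\; 0_{2n\times(p-q)}\right]T^\top,$$ where $q\le p$, $\hat S=[\hat S_1\;\hat S_2]\in\mathrm{Sp}(2q,2n)$ (with $\hat S_1,\hat S_2\in\mathbb{R}^{2n\times q}$) consists of $q$ symplectic eigenvector pairs of $A$, diagonalizing $A$ in the sense $\hat S^\top A\hat S=\hat D\oplus\hat D$ with $\hat D\in\mathbb{R}^{q\times q}$ diagonal and $\beta I_q\succ\hat D\succ0$, and $T\in\mathrm{OrSp}(2p)$.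
   Context: For a positive integer $k$, $J_k=\begin{bmatrix}0&I_k\\-I_k&0\end{bmatrix}\in\mathbb{R}^{2k\times 2k}$. $\mathrm{Sp}(2q,2n)=\{X\in\mathbb{R}^{2n\times 2q}:X^\top J_nX=J_q\}$. $\mathrm{OrSp}(2p)$ is the set of $2p\times 2p$ real matrices $T$ that are orthogonal and satisfy $T^\top J_pT=J_p$. $B\oplus C$ denotes the block-diagonal matrix with diagonal blocks $B,C$. $0_{2n\times(p-q)}$ is the zero matrix (absent if $q=p$); $q\geq 0$ is an integer, and $q=0$ corresponds to $X=0$. Symplectic eigenvector pairs: $\hat S=[\hat S_1\;\hat S_2]\in\mathrm{Sp}(2q,2n)$, with columns $\hat s_1,\dots,\hat s_{2q}$, consists of $q$ symplectic eigenvector pairs of $A$ with symplectic eigenvalues $\hat d_1,\dots,\hat d_q$ (the diagonal of $\hat D$) if $A[\hat s_i,\hat s_{i+q}]=\hat d_iJ_n[\hat s_i,\hat s_{i+q}]J_1^\top$ for $1\le i\le q$. *)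

theory Defs
  imports Complex_Main "Jordan_Normal_Form.Matrix"
begin

definition trace_mat :: "real mat \<Rightarrow> real" where
  "trace_mat M = (\<Sum>i<dim_row M. M $$ (i,i))"

definition frob_inner :: "real mat \<Rightarrow> real mat \<Rightarrow> real" where
  "frob_inner M N = trace_mat (M\<^sup>T * N)"

definition frob_norm :: "real mat \<Rightarrow> real" where
  "frob_norm M = sqrt (frob_inner M M)"

text \<open>
  The type of matrices of arbitrary dimension is not a normed vector space, so Frechet
  differentiability on the space of matrices of the size of \<open>X\<close> is written out here:
  \<open>f (X + H) = f X + \<langle>G, H\<rangle> + o(\<parallel>H\<parallel>)\<close> as \<open>H \<rightarrow> 0\<close>, for the Frobenius inner product and norm.
\<close>

definition has_mat_gradient :: "(real mat \<Rightarrow> real) \<Rightarrow> real mat \<Rightarrow> real mat \<Rightarrow> bool" where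
  "has_mat_gradient f G X \<longleftrightarrow>
     G \<in> carrier_mat (dim_row X) (dim_col X) \<and>
     (\<forall>e>0. \<exists>d>0. \<forall>H \<in> carrier_mat (dim_row X) (dim_col X).
        frob_norm H < d \<longrightarrow> \<bar>f (X + H) - f X - frob_inner G H\<bar> \<le> e * frob_norm H)"

definition pos_def_mat :: "real mat \<Rightarrow> bool" where
  "pos_def_mat M \<longleftrightarrow> square_mat M \<and> M\<^sup>T = M \<and>
     (\<forall>v \<in> carrier_vec (dim_row M). v \<noteq> 0\<^sub>v (dim_row M) \<longrightarrow> 0 < v \<bullet> (M *\<^sub>v v))"

definition pos_semidef_mat :: "real mat \<Rightarrow> bool" where
  "pos_semidef_mat M \<longleftrightarrow> square_mat M \<and> M\<^sup>T = M \<and>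
     (\<forall>v \<in> carrier_vec (dim_row M). 0 \<le> v \<bullet> (M *\<^sub>v v))"

text \<open>Only meaningful for positive semidefinite \<open>M\<close>, where such an \<open>R\<close> exists uniquely.\<close>

definition mat_sqrt :: "real mat \<Rightarrow> real mat" where
  "mat_sqrt M = (THE R. R \<in> carrier_mat (dim_row M) (dim_row M) \<and> pos_semidef_mat R \<and> R * R = M)"

definition append_cols :: "real mat \<Rightarrow> real mat \<Rightarrow> real mat" (infixr \<open>@\<^sub>c\<close> 65) where
  "A @\<^sub>c B = four_block_mat A B (0\<^sub>m 0 (dim_col A)) (0\<^sub>m 0 (dim_col B))"

definition J_mat :: "nat \<Rightarrow> real mat" where
  "J_mat k = four_block_mat (0\<^sub>m k k) (1\<^sub>m k) (- 1\<^sub>m k) (0\<^sub>m k k)"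

text \<open>The column half-dimension \<open>q\<close> comes first; \<open>q = 0\<close> gives the empty \<open>2n \<times> 0\<close> matrix.\<close>

definition Sp :: "nat \<Rightarrow> nat \<Rightarrow> real mat set" where
  "Sp q n = {S \<in> carrier_mat (2 * n) (2 * q). S\<^sup>T * J_mat n * S = J_mat q}"

definition OrSp :: "nat \<Rightarrow> real mat set" where
  "OrSp p = {T \<in> carrier_mat (2 * p) (2 * p).
     T\<^sup>T * T = 1\<^sub>m (2 * p) \<and> T\<^sup>T * J_mat p * T = J_mat p}"

definition symplectic_eigenvector_pairs ::
    "nat \<Rightarrow> nat \<Rightarrow> real mat \<Rightarrow> real mat \<Rightarrow> real mat \<Rightarrow> bool" where
  "symplectic_eigenvector_pairs n q A S D \<longleftrightarrow> S \<in> Sp q n \<and>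
     (\<forall>i<q. let P = mat_of_cols (2 * n) [col S i, col S (i + q)]
            in A * P = D $$ (i,i) \<cdot>\<^sub>m (J_mat n * P * (J_mat 1)\<^sup>T))"

definition f_beta :: "nat \<Rightarrow> nat \<Rightarrow> real mat \<Rightarrow> real \<Rightarrow> real mat \<Rightarrow> real" where
  "f_beta n p A \<beta> X = 1 / 2 * trace_mat (X\<^sup>T * A * X) +
     \<beta> / 4 * (frob_norm (X\<^sup>T * J_mat n * X - J_mat p))\<^sup>2"

end

theory Submission
  imports Defs "HOL-Analysis.L2_Norm" "Jordan_Normal_Form.Schur_Decomposition"
begin

text \<open>
The gradient of \<open>f_beta\<close> at \<open>X\<close> is \<open>A X - \<beta> J X (M - J)\<close> with the skew matrix \<open>M = X\<^sup>T J X\<close>, so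
\<open>X\<close> is stationary iff \<open>A X = \<beta> J X (M - J)\<close> (\<open>f_beta_stationary_iff\<close>); everything else is linear
algebra of this equation.

Multiplying it by \<open>X\<^sup>T\<close> gives \<open>X\<^sup>T A X = \<beta> M (M - J)\<close>. The left side is symmetric and \<open>M\<close> is skew,
which forces \<open>M J = J M\<close>. Real \<open>2p \<times> 2p\<close> matrices commuting with \<open>J\<close> are the complex \<open>p \<times> p\<close>
matrices in disguise, with \<open>J\<close> in the role of \<open>\<i>\<close>, the transpose in that of the adjoint, and the
orthosymplectic matrices in that of the unitary ones. The symmetric matrix \<open>N = - J M\<close> thus
corresponds to a Hermitian one, and the complex spectral theorem yields an orthosymplectic \<open>T\<close>
with \<open>T\<^sup>T M T = J (E \<oplus> E)\<close>, \<open>E\<close> diagonal with its nonzero entries first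
(\<open>orthosymplectic_diagonalization\<close>).

For \<open>Y = X T\<close> this says \<open>Y\<^sup>T J Y = J (E \<oplus> E)\<close>: the columns of \<open>Y\<close> form a symplectic frame up to the
scaling factors \<open>e i\<close>. The stationarity equation is invariant under \<open>X \<mapsto> X T\<close>, and for such a \<open>Y\<close> it
says precisely that the pair of columns \<open>i, p + i\<close> satisfies the symplectic eigenvector equation with
eigenvalue \<open>\<beta> (1 - e i)\<close> (\<open>symplectic_frame_stationary_iff\<close>). Then
\<open>Y\<^sup>T A Y\<close> is diagonal with entries \<open>\<beta> e i (1 - e i)\<close>; by positive definiteness of \<open>A\<close> the pairs with
\<open>e i = 0\<close> vanish and the others have \<open>0 < e i < 1\<close> (\<open>eigen_frame_pos_def\<close>). Dividing the nonzero
pairs by \<open>sqrt (e i)\<close> gives \<open>S\<close>, with eigenvalues \<open>d i = \<beta> (1 - e i)\<close>, so that the scaling factor is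
\<open>sqrt (e i) = sqrt (1 - d i / \<beta>)\<close>. The converse runs the same equivalences backwards, starting from
\<open>S\<close> and scaling its columns.
\<close>

section \<open>The Frobenius inner product and norm\<close>

lemma trace_mat_mult_eq_sum:
  assumes "M \<in> carrier_mat r c" "N \<in> carrier_mat c r"
  shows "trace_mat (M * N) = (\<Sum>i<r. \<Sum>j<c. M $$ (i,j) * N $$ (j,i))"
  using assms by (auto simp: trace_mat_def scalar_prod_def atLeast0LessThan intro!: sum.cong)

lemma frob_inner_eq_sum:
  assumes "M \<in> carrier_mat r c" "N \<in> carrier_mat r c"
  shows "frob_inner M N = (\<Sum>i<r. \<Sum>j<c. M $$ (i,j) * N $$ (i,j))"
  using assms unfolding frob_inner_def
  by (subst trace_mat_mult_eq_sum[of _ c r]) (auto intro!: sum.cong simp: sum.swap[of _ "{..<c}"])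

lemma frob_inner_commute:
  assumes "M \<in> carrier_mat r c" "N \<in> carrier_mat r c"
  shows "frob_inner M N = frob_inner N M"
  by (simp add: frob_inner_eq_sum[OF assms] frob_inner_eq_sum[OF assms(2,1)] mult.commute)

lemma frob_inner_add_right:
  assumes "M \<in> carrier_mat r c" "N \<in> carrier_mat r c" "P \<in> carrier_mat r c"
  shows "frob_inner M (N + P) = frob_inner M N + frob_inner M P"
proof -
  have "N + P \<in> carrier_mat r c" using assms by auto
  then show ?thesis
    using assms by (simp add: frob_inner_eq_sum[of M r c] distrib_left sum.distrib)
qed

lemma frob_inner_add_left:
  assumes "M \<in> carrier_mat r c" "N \<in> carrier_mat r c" "P \<in> carrier_mat r c"
  shows "frob_inner (M + N) P = frob_inner M P + frob_inner N P"
  using assms by (simp add: frob_inner_commute[of _ r c P] frob_inner_add_right[of P r c])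

lemma frob_inner_smult_right:
  assumes "M \<in> carrier_mat r c" "N \<in> carrier_mat r c"
  shows "frob_inner M (t \<cdot>\<^sub>m N) = t * frob_inner M N"
proof -
  have "t \<cdot>\<^sub>m N \<in> carrier_mat r c" using assms by auto
  then show ?thesis
    using assms by (simp add: frob_inner_eq_sum[of M r c] sum_distrib_left mult.left_commute)
qed

lemma frob_inner_minus_left:
  assumes "M \<in> carrier_mat r c" "N \<in> carrier_mat r c" "P \<in> carrier_mat r c"
  shows "frob_inner (M - N) P = frob_inner M P - frob_inner N P"
proof -
  have "M - N \<in> carrier_mat r c" using assms by auto
  then show ?thesis
    using assms by (simp add: frob_inner_eq_sum[of _ r c] left_diff_distrib sum_subtractf)
qed

lemma frob_inner_mult_left:
  assumes "M \<in> carrier_mat r c" "B \<in> carrier_mat r s" "N \<in> carrier_mat s c"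
  shows "frob_inner M (B * N) = frob_inner (B\<^sup>T * M) N"
  using assms by (simp add: frob_inner_def transpose_mult[of _ s r] assoc_mult_mat[of _ c r _ s])

lemma frob_inner_transpose:
  assumes "M \<in> carrier_mat r c" "N \<in> carrier_mat r c"
  shows "frob_inner M\<^sup>T N\<^sup>T = frob_inner M N"
  using assms by (simp add: frob_inner_eq_sum[of M r c] frob_inner_eq_sum[of "M\<^sup>T" c r])
    (rule sum.swap)

lemma frob_norm_eq_L2_set:
  assumes "M \<in> carrier_mat r c"
  shows "frob_norm M = L2_set (($$) M) ({..<r} \<times> {..<c})"
  by (simp add: frob_norm_def frob_inner_eq_sum[OF assms assms] L2_set_def
      sum.cartesian_product power2_eq_square split_def)

lemma frob_norm_nonneg:
  assumes "M \<in> carrier_mat r c"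
  shows "0 \<le> frob_norm M"
  using assms by (simp add: frob_norm_eq_L2_set)

lemma frob_norm_square:
  assumes "M \<in> carrier_mat r c"
  shows "(frob_norm M)\<^sup>2 = frob_inner M M"
  unfolding frob_norm_def
  by (rule real_sqrt_pow2) (auto simp: frob_inner_eq_sum[OF assms assms] intro!: sum_nonneg)

lemma frob_norm_eq_0D:
  assumes "M \<in> carrier_mat r c" "frob_norm M = 0"
  shows "M = 0\<^sub>m r c"
  using assms by (intro eq_matI) (auto simp: frob_norm_eq_L2_set L2_set_eq_0_iff)

lemma abs_frob_inner_le:
  assumes "M \<in> carrier_mat r c" "N \<in> carrier_mat r c"
  shows "\<bar>frob_inner M N\<bar> \<le> frob_norm M * frob_norm N"
proof -
  let ?I = "{..<r} \<times> {..<c}"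
  have "frob_inner M N = (\<Sum>i\<in>?I. M $$ i * N $$ i)"
    by (simp add: frob_inner_eq_sum[OF assms] sum.cartesian_product split_def)
  also have "\<bar>\<dots>\<bar> \<le> (\<Sum>i\<in>?I. \<bar>M $$ i\<bar> * \<bar>N $$ i\<bar>)"
    by (rule order_trans[OF sum_abs]) (simp add: abs_mult)
  also have "\<dots> \<le> frob_norm M * frob_norm N"
    unfolding frob_norm_eq_L2_set[OF assms(1)] frob_norm_eq_L2_set[OF assms(2)]
    by (rule L2_set_mult_ineq)
  finally show ?thesis .
qed

lemma frob_norm_triangle:
  assumes "M \<in> carrier_mat r c" "N \<in> carrier_mat r c"
  shows "frob_norm (M + N) \<le> frob_norm M + frob_norm N"
proof -
  have "M + N \<in> carrier_mat r c" using assms by auto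
  then have "frob_norm (M + N) = L2_set (\<lambda>i. M $$ i + N $$ i) ({..<r} \<times> {..<c})"
    unfolding frob_norm_eq_L2_set[OF \<open>M + N \<in> carrier_mat r c\<close>]
    using assms by (intro L2_set_cong) auto
  then show ?thesis
    using assms by (simp add: frob_norm_eq_L2_set L2_set_triangle_ineq)
qed

lemma frob_norm_smult:
  assumes "M \<in> carrier_mat r c"
  shows "frob_norm (t \<cdot>\<^sub>m M) = \<bar>t\<bar> * frob_norm M"
proof -
  have c: "t \<cdot>\<^sub>m M \<in> carrier_mat r c" using assms by auto
  have "frob_inner (t \<cdot>\<^sub>m M) (t \<cdot>\<^sub>m M) = t\<^sup>2 * frob_inner M M"
    using assms c by (simp add: frob_inner_eq_sum[of _ r c] sum_distrib_left power2_eq_square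
        mult_ac)
  then show ?thesis by (simp add: frob_norm_def real_sqrt_mult)
qed

lemma frob_norm_transpose:
  assumes "M \<in> carrier_mat r c"
  shows "frob_norm M\<^sup>T = frob_norm M"
  using assms by (simp add: frob_norm_def frob_inner_transpose)

text \<open>
By Cauchy and Schwarz, each entry of the product is bounded by the norm of a row of \<open>M\<close> times the
norm of a column of \<open>N\<close>; the squares of these bounds sum to the product of the squared norms.
\<close>

lemma frob_norm_mult_le:
  assumes M: "M \<in> carrier_mat r s" and N: "N \<in> carrier_mat s c"
  shows "frob_norm (M * N) \<le> frob_norm M * frob_norm N"
proof (rule power2_le_imp_le)
  have MN: "M * N \<in> carrier_mat r c" using M N by auto
  define m where "m i = L2_set (\<lambda>k. M $$ (i,k)) {..<s}" for i
  define l where "l j = L2_set (\<lambda>k. N $$ (k,j)) {..<s}" for j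
  have entry: "((M * N) $$ (i,j))\<^sup>2 \<le> (m i)\<^sup>2 * (l j)\<^sup>2" if "i < r" "j < c" for i j
  proof -
    have "(M * N) $$ (i,j) = (\<Sum>k<s. M $$ (i,k) * N $$ (k,j))"
      using that M N by (auto simp: scalar_prod_def atLeast0LessThan intro!: sum.cong)
    also have "\<bar>\<dots>\<bar> \<le> (\<Sum>k<s. \<bar>M $$ (i,k)\<bar> * \<bar>N $$ (k,j)\<bar>)"
      by (rule order_trans[OF sum_abs]) (simp add: abs_mult)
    also have "\<dots> \<le> m i * l j"
      unfolding m_def l_def by (rule L2_set_mult_ineq)
    finally have "\<bar>(M * N) $$ (i,j)\<bar>\<^sup>2 \<le> (m i * l j)\<^sup>2"
      by (rule power_mono) simp
    then show ?thesis by (simp add: power_mult_distrib)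
  qed
  have "(frob_norm (M * N))\<^sup>2 = (\<Sum>i<r. \<Sum>j<c. ((M * N) $$ (i,j))\<^sup>2)"
    unfolding frob_norm_square[OF MN] frob_inner_eq_sum[OF MN MN] by (simp add: power2_eq_square)
  also have "\<dots> \<le> (\<Sum>i<r. \<Sum>j<c. (m i)\<^sup>2 * (l j)\<^sup>2)"
    by (intro sum_mono) (use entry in auto)
  also have "\<dots> = (\<Sum>i<r. (m i)\<^sup>2) * (\<Sum>j<c. (l j)\<^sup>2)"
    by (simp add: sum_product)
  also have "(\<Sum>i<r. (m i)\<^sup>2) = (frob_norm M)\<^sup>2"
    unfolding frob_norm_square[OF M] frob_inner_eq_sum[OF M M] m_def L2_set_def
    by (simp add: sum_nonneg power2_eq_square)
  also have "(\<Sum>j<c. (l j)\<^sup>2) = (frob_norm N)\<^sup>2"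
    unfolding frob_norm_square[OF N] frob_inner_eq_sum[OF N N] l_def L2_set_def
    by (subst sum.swap) (simp add: sum_nonneg power2_eq_square)
  finally show "(frob_norm (M * N))\<^sup>2 \<le> (frob_norm M * frob_norm N)\<^sup>2"
    by (simp add: power_mult_distrib)
  show "0 \<le> frob_norm M * frob_norm N"
    using frob_norm_nonneg[OF M] frob_norm_nonneg[OF N] by simp
qed

lemma has_mat_gradientI_quadratic_remainder:
  assumes X: "X \<in> carrier_mat r c" and G: "G \<in> carrier_mat r c"
    and C: "\<And>H. H \<in> carrier_mat r c \<Longrightarrow> frob_norm H \<le> 1 \<Longrightarrow>
      \<bar>f (X + H) - f X - frob_inner G H\<bar> \<le> C * (frob_norm H)\<^sup>2"
  shows "has_mat_gradient f G X"
  unfolding has_mat_gradient_def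
proof (intro conjI allI impI)
  show "G \<in> carrier_mat (dim_row X) (dim_col X)" using X G by auto
  fix e :: real assume e: "0 < e"
  define d where "d = min 1 (e / (\<bar>C\<bar> + 1))"
  have d: "0 < d" "d \<le> 1" "\<bar>C\<bar> * d \<le> e"
  proof -
    show "0 < d" "d \<le> 1" using e by (auto simp: d_def)
    have "\<bar>C\<bar> * d \<le> (\<bar>C\<bar> + 1) * (e / (\<bar>C\<bar> + 1))"
      using e by (intro mult_mono) (auto simp: d_def)
    then show "\<bar>C\<bar> * d \<le> e" by simp
  qed
  show "\<exists>d>0. \<forall>H\<in>carrier_mat (dim_row X) (dim_col X). frob_norm H < d \<longrightarrow>
      \<bar>f (X + H) - f X - frob_inner G H\<bar> \<le> e * frob_norm H"
  proof (intro exI[of _ d] conjI ballI impI)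
    fix H assume "H \<in> carrier_mat (dim_row X) (dim_col X)" and Hd: "frob_norm H < d"
    then have H: "H \<in> carrier_mat r c" using X by auto
    have "\<bar>f (X + H) - f X - frob_inner G H\<bar> \<le> C * (frob_norm H)\<^sup>2"
      using C[OF H] Hd d by simp
    also have "\<dots> \<le> \<bar>C\<bar> * (d * frob_norm H)"
      unfolding power2_eq_square using Hd frob_norm_nonneg[OF H]
      by (intro mult_mono) auto
    also have "\<dots> \<le> e * frob_norm H"
      using mult_right_mono[OF d(3) frob_norm_nonneg[OF H]] by (simp add: mult.assoc)
    finally show "\<bar>f (X + H) - f X - frob_inner G H\<bar> \<le> e * frob_norm H" .
  qed (fact d(1))
qed

text \<open>
If \<open>G - G'\<close> were nonzero, a small increment \<open>H\<close> in its direction would make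
\<open>\<langle>G - G', H\<rangle> = \<parallel>G - G'\<parallel> \<parallel>H\<parallel>\<close>, while both linear approximations hold up to an arbitrarily small
multiple of \<open>\<parallel>H\<parallel>\<close>.
\<close>

lemma has_mat_gradient_unique:
  assumes X: "X \<in> carrier_mat r c"
    and G: "has_mat_gradient f G X" and G': "has_mat_gradient f G' X"
  shows "G = G'"
proof -
  have Gc: "G \<in> carrier_mat r c" and Gc': "G' \<in> carrier_mat r c"
    using G G' X unfolding has_mat_gradient_def by auto
  define W where "W = G - G'"
  have W: "W \<in> carrier_mat r c" unfolding W_def using Gc Gc' by (intro minus_carrier_mat) auto
  define w where "w = frob_norm W"
  have w0: "0 \<le> w" unfolding w_def by (rule frob_norm_nonneg[OF W])
  have "w = 0"
  proof (rule ccontr)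
    assume "w \<noteq> 0"
    then have w: "0 < w" using w0 by simp
    \<comment> \<open>Two errors of \<open>w / 4\<close> each stay below the slope \<open>w\<close> in the direction of \<open>W\<close>.\<close>
    define e where "e = w / 4"
    have e: "0 < e" using w by (simp add: e_def)
    obtain d1 where d1: "0 < d1" "\<And>H. H \<in> carrier_mat r c \<Longrightarrow> frob_norm H < d1 \<Longrightarrow>
        \<bar>f (X + H) - f X - frob_inner G H\<bar> \<le> e * frob_norm H"
      using G X e unfolding has_mat_gradient_def by fastforce
    obtain d2 where d2: "0 < d2" "\<And>H. H \<in> carrier_mat r c \<Longrightarrow> frob_norm H < d2 \<Longrightarrow>
        \<bar>f (X + H) - f X - frob_inner G' H\<bar> \<le> e * frob_norm H"
      using G' X e unfolding has_mat_gradient_def by fastforce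
    define t where "t = min d1 d2 / (2 * w)"
    have t: "0 < t" using d1(1) d2(1) w by (simp add: t_def)
    define H where "H = t \<cdot>\<^sub>m W"
    have H: "H \<in> carrier_mat r c" using W by (simp add: H_def)
    have nH: "frob_norm H = t * w" using t by (simp add: H_def frob_norm_smult[OF W] w_def)
    have "frob_norm H = min d1 d2 / 2" using w by (simp add: nH t_def)
    then have small: "frob_norm H < d1" "frob_norm H < d2" using d1(1) d2(1) by auto
    have "frob_inner G H - frob_inner G' H = t * w\<^sup>2"
      using frob_inner_minus_left[OF Gc Gc' H] frob_inner_smult_right[OF W W, of t]
      by (simp add: W_def[symmetric] H_def w_def frob_norm_square[OF W])
    moreover have "\<bar>frob_inner G H - frob_inner G' H\<bar> \<le> 2 * (e * frob_norm H)"
      using d1(2)[OF H small(1)] d2(2)[OF H small(2)] by linarith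
    ultimately have "t * w\<^sup>2 \<le> t * w\<^sup>2 / 2"
      using t by (simp add: e_def nH power2_eq_square)
    then show False using t w by simp
  qed
  then have W0: "W = 0\<^sub>m r c" unfolding w_def by (rule frob_norm_eq_0D[OF W])
  show ?thesis
  proof (rule eq_matI)
    fix i j assume ij: "i < dim_row G'" "j < dim_col G'"
    then have "W $$ (i,j) = G $$ (i,j) - G' $$ (i,j)" using Gc Gc' by (auto simp: W_def)
    then show "G $$ (i,j) = G' $$ (i,j)" using ij Gc' by (auto simp: W0)
  qed (use Gc Gc' in auto)
qed

section \<open>The stationarity equation\<close>

lemma J_mat_carrier [simp]: "J_mat k \<in> carrier_mat (2 * k) (2 * k)"
  by (auto simp: J_mat_def intro!: carrier_matI)

lemma dim_J_mat [simp]: "dim_row (J_mat k) = 2 * k" "dim_col (J_mat k) = 2 * k"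
  using J_mat_carrier[of k] by (auto simp del: J_mat_carrier)

lemma J_mat_index:
  assumes "i < 2 * k" "j < 2 * k"
  shows "J_mat k $$ (i,j) = (if j = i + k then 1 else if i = j + k then - 1 else 0)"
  using assms by (auto simp: J_mat_def)

lemma transpose_J_mat: "(J_mat k)\<^sup>T = - J_mat k"
  using J_mat_carrier[of k] by (intro eq_matI) (auto simp: J_mat_index simp del: J_mat_carrier)

lemma symplectic_gram_skew:
  assumes "X \<in> carrier_mat (2 * n) m"
  shows "(X\<^sup>T * J_mat n * X)\<^sup>T = - (X\<^sup>T * J_mat n * X)"
proof -
  have "(X\<^sup>T * J_mat n * X)\<^sup>T = X\<^sup>T * ((J_mat n)\<^sup>T * X)"
    using assms by (simp add: transpose_mult[of _ m "2 * n"] transpose_mult[of _ "2 * n" "2 * n"]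
        transpose_mult[of _ m "2 * n" _ "2 * n"])
  also have "\<dots> = - (X\<^sup>T * J_mat n * X)"
    using assms by (simp add: transpose_J_mat assoc_mult_mat[of _ m "2 * n" _ "2 * n" _ m])
  finally show ?thesis .
qed

text \<open>
With \<open>K = X\<^sup>T J X - J\<close>, the increment of \<open>K\<close> under \<open>X \<mapsto> X + H\<close> is \<open>L1 + L2 + Q\<close> with
\<open>L1 = X\<^sup>T J H\<close>, \<open>L2 = H\<^sup>T J X\<close> linear and \<open>Q = H\<^sup>T J H\<close> quadratic in \<open>H\<close>. Since \<open>K\<close> and \<open>J\<close> are
skew, both linear terms have the inner product \<open>- \<langle>J X K, H\<rangle>\<close> with \<open>K\<close>, which explains the
second term of the gradient. The other terms of the penalty are of second order in \<open>H\<close>.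
\<close>

lemma f_beta_has_mat_gradient:
  assumes A: "A \<in> carrier_mat (2 * n) (2 * n)" and sym: "A\<^sup>T = A"
    and X: "X \<in> carrier_mat (2 * n) (2 * p)" and "0 < \<beta>"
  shows "has_mat_gradient (f_beta n p A \<beta>)
    (A * X - \<beta> \<cdot>\<^sub>m (J_mat n * X * (X\<^sup>T * J_mat n * X - J_mat p))) X"
proof -
  let ?N = "2 * n" and ?P = "2 * p"
  define W where "W = J_mat n"
  define J where "J = J_mat p"
  have W: "W \<in> carrier_mat ?N ?N" and J: "J \<in> carrier_mat ?P ?P" by (simp_all add: W_def J_def)
  have WT: "W\<^sup>T = - W" and JT: "J\<^sup>T = - J" by (simp_all add: W_def J_def transpose_J_mat)
  define K where "K = X\<^sup>T * W * X - J"
  have K: "K \<in> carrier_mat ?P ?P" using X W J by (auto simp: K_def)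
  have KT: "K\<^sup>T = - K"
  proof -
    have "K\<^sup>T = (X\<^sup>T * W * X)\<^sup>T - J\<^sup>T" unfolding K_def
      using X W J by (intro transpose_minus) auto
    also have "(X\<^sup>T * W * X)\<^sup>T = - (X\<^sup>T * W * X)" unfolding W_def by (rule symplectic_gram_skew[OF X])
    finally show ?thesis using X W J by (auto simp: K_def JT intro!: eq_matI)
  qed
  define V where "V = W * X * K"
  have V: "V \<in> carrier_mat ?N ?P" using W X K by (auto simp: V_def)
  define G where "G = A * X - \<beta> \<cdot>\<^sub>m V"
  have G: "G \<in> carrier_mat ?N ?P" using V by (auto simp: G_def intro!: minus_carrier_mat)
  define C where "C = frob_norm A / 2 + \<beta> / 2 * (frob_norm K * frob_norm W)
      + \<beta> / 4 * (2 * (frob_norm W * frob_norm X) + frob_norm W)\<^sup>2"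
  have "has_mat_gradient (f_beta n p A \<beta>) G X"
  proof (rule has_mat_gradientI_quadratic_remainder[OF X G, of _ C])
    fix H :: "real mat" assume H: "H \<in> carrier_mat ?N ?P" and H1: "frob_norm H \<le> 1"
    define h where "h = frob_norm H"
    have h: "0 \<le> h" "h \<le> 1" using frob_norm_nonneg[OF H] H1 by (auto simp: h_def)
    define L1 where "L1 = X\<^sup>T * W * H"
    define L2 where "L2 = H\<^sup>T * W * X"
    define Q where "Q = H\<^sup>T * W * H"
    have L1: "L1 \<in> carrier_mat ?P ?P" and L2: "L2 \<in> carrier_mat ?P ?P" and Q: "Q \<in> carrier_mat ?P ?P"
      using X W H by (auto simp: L1_def L2_def Q_def)
    note cs = A W J X H K L1 L2 Q V G
    have split: "(X + H)\<^sup>T * W * (X + H) - J = K + (L1 + L2 + Q)"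
    proof -
      have "(X + H)\<^sup>T * W * (X + H) = (X\<^sup>T + H\<^sup>T) * W * (X + H)"
        using X H by (simp add: transpose_add[of X ?N ?P H])
      also have "(X\<^sup>T + H\<^sup>T) * W = X\<^sup>T * W + H\<^sup>T * W"
        using X H W by (intro add_mult_distrib_mat) auto
      also have "(X\<^sup>T * W + H\<^sup>T * W) * (X + H) = (X\<^sup>T * W + H\<^sup>T * W) * X + (X\<^sup>T * W + H\<^sup>T * W) * H"
        using X H W by (intro mult_add_distrib_mat) auto
      also have "(X\<^sup>T * W + H\<^sup>T * W) * X = X\<^sup>T * W * X + L2" unfolding L2_def
        using X H W by (intro add_mult_distrib_mat[of _ ?P ?N]) auto
      also have "(X\<^sup>T * W + H\<^sup>T * W) * H = L1 + Q" unfolding L1_def Q_def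
        using X H W by (intro add_mult_distrib_mat[of _ ?P ?N]) auto
      finally have eq: "(X + H)\<^sup>T * W * (X + H) = X\<^sup>T * W * X + L2 + (L1 + Q)" .
      define E where "E = X\<^sup>T * W * X"
      have "E \<in> carrier_mat ?P ?P" using X W by (auto simp: E_def)
      then show ?thesis unfolding eq K_def E_def[symmetric] using cs by (auto intro!: eq_matI)
    qed
    have KL1: "frob_inner K L1 = - frob_inner V H"
    proof -
      have "frob_inner K L1 = frob_inner ((X\<^sup>T * W)\<^sup>T * K) H" unfolding L1_def
        using cs by (intro frob_inner_mult_left[of _ ?P ?P]) auto
      also have "(X\<^sup>T * W)\<^sup>T * K = - V"
        using cs by (simp add: V_def transpose_mult[of _ ?P ?N _ ?N] WT)
      also have "frob_inner (- V) H = - frob_inner V H"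
        using cs by (simp add: frob_inner_eq_sum[of _ ?N ?P] sum_negf)
      finally show ?thesis .
    qed
    have KL2: "frob_inner K L2 = frob_inner K L1"
    proof -
      have "L2\<^sup>T = - L1"
        using cs by (simp add: L1_def L2_def transpose_mult[of _ ?P ?N _ ?P] transpose_mult[of _ ?N ?N _ ?P]
            WT assoc_mult_mat[of _ ?P ?N _ ?N _ ?P])
      then have "frob_inner K L2 = frob_inner (- K) (- L1)"
        using frob_inner_transpose[OF K L2] by (simp add: KT)
      also have "\<dots> = frob_inner K L1"
        using cs by (simp add: frob_inner_eq_sum[of _ ?P ?P])
      finally show ?thesis .
    qed
    have tr: "trace_mat (Y\<^sup>T * A * Y) = frob_inner Y (A * Y)" if "Y \<in> carrier_mat ?N ?P" for Y
      using that A by (simp add: frob_inner_def assoc_mult_mat[of _ ?P ?N _ ?N _ ?P])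
    have XH: "X + H \<in> carrier_mat ?N ?P" using X H by auto
    have AX: "A * X \<in> carrier_mat ?N ?P" and AH: "A * H \<in> carrier_mat ?N ?P" using A X H by auto
    have quad: "trace_mat ((X + H)\<^sup>T * A * (X + H)) =
        trace_mat (X\<^sup>T * A * X) + 2 * frob_inner (A * X) H + frob_inner H (A * H)"
    proof -
      have "A * (X + H) = A * X + A * H" using A X H by (intro mult_add_distrib_mat) auto
      then have "frob_inner (X + H) (A * (X + H)) =
         frob_inner X (A * X) + frob_inner X (A * H) + frob_inner H (A * X) + frob_inner H (A * H)"
        using X H AX AH by (simp add: frob_inner_add_left[of _ ?N ?P] frob_inner_add_right[of _ ?N ?P])
      moreover have "frob_inner X (A * H) = frob_inner (A * X) H"
        using frob_inner_mult_left[OF X A H] by (simp add: sym)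
      moreover have "frob_inner H (A * X) = frob_inner (A * X) H"
        by (rule frob_inner_commute[OF H AX])
      ultimately show ?thesis by (simp add: tr[OF XH] tr[OF X])
    qed
    define M where "M = L1 + L2 + Q"
    have M: "M \<in> carrier_mat ?P ?P" using cs by (auto simp: M_def)
    have pen: "(frob_norm (K + M))\<^sup>2 = (frob_norm K)\<^sup>2
        + 2 * (- 2 * frob_inner V H + frob_inner K Q) + (frob_norm M)\<^sup>2"
    proof -
      have "frob_inner K M = - 2 * frob_inner V H + frob_inner K Q"
        using cs by (simp add: M_def frob_inner_add_right[of _ ?P ?P] KL1 KL2)
      moreover have "frob_inner (K + M) (K + M) =
          frob_inner K K + 2 * frob_inner K M + frob_inner M M"
        using K M by (simp add: frob_inner_add_right[of _ ?P ?P] frob_inner_add_left[of _ ?P ?P]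
            frob_inner_commute[OF M K])
      moreover have "K + M \<in> carrier_mat ?P ?P" using K M by auto
      ultimately show ?thesis using K M by (simp add: frob_norm_square[of _ ?P ?P])
    qed
    have GH: "frob_inner G H = frob_inner (A * X) H - \<beta> * frob_inner V H"
      unfolding G_def using frob_inner_minus_left[OF AX _ H, of "\<beta> \<cdot>\<^sub>m V"] V H
      by (simp add: frob_inner_commute[of _ ?N ?P H] frob_inner_smult_right[of H ?N ?P])
    have rem: "f_beta n p A \<beta> (X + H) - f_beta n p A \<beta> X - frob_inner G H =
        1 / 2 * frob_inner H (A * H) + \<beta> / 2 * frob_inner K Q + \<beta> / 4 * (frob_norm M)\<^sup>2"
      unfolding f_beta_def W_def[symmetric] J_def[symmetric] split K_def[symmetric] quad
        M_def[symmetric] pen GH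
      by (simp add: algebra_simps)
    have b1: "\<bar>frob_inner H (A * H)\<bar> \<le> frob_norm A * h\<^sup>2"
    proof -
      have "\<bar>frob_inner H (A * H)\<bar> \<le> h * frob_norm (A * H)"
        unfolding h_def by (rule abs_frob_inner_le[OF H AH])
      also have "\<dots> \<le> h * (frob_norm A * h)"
        unfolding h_def by (intro mult_left_mono frob_norm_mult_le[OF A H] frob_norm_nonneg[OF H])
      finally show ?thesis by (simp add: power2_eq_square mult_ac)
    qed
    have nn: "0 \<le> frob_norm A" "0 \<le> frob_norm W" "0 \<le> frob_norm X" "0 \<le> frob_norm K" "0 \<le> frob_norm M"
      using frob_norm_nonneg A W X K M by blast+
    have tri: "frob_norm (Y\<^sup>T * W * Z) \<le> frob_norm Y * frob_norm W * frob_norm Z"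
      if "Y \<in> carrier_mat ?N ?P" "Z \<in> carrier_mat ?N ?P" for Y Z
    proof -
      have YW: "Y\<^sup>T * W \<in> carrier_mat ?P ?N" using that W by auto
      have YT: "Y\<^sup>T \<in> carrier_mat ?P ?N" using that by auto
      have "frob_norm (Y\<^sup>T * W * Z) \<le> frob_norm (Y\<^sup>T * W) * frob_norm Z"
        by (rule frob_norm_mult_le[OF YW that(2)])
      also have "\<dots> \<le> (frob_norm Y\<^sup>T * frob_norm W) * frob_norm Z"
        by (intro mult_right_mono frob_norm_mult_le[OF YT W] frob_norm_nonneg[OF that(2)])
      finally show ?thesis by (simp add: frob_norm_transpose[OF that(1)])
    qed
    have nQ: "frob_norm Q \<le> frob_norm W * h\<^sup>2"
      using tri[OF H H] by (simp add: Q_def h_def power2_eq_square mult_ac)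
    have b2: "\<bar>frob_inner K Q\<bar> \<le> frob_norm K * frob_norm W * h\<^sup>2"
    proof -
      have "\<bar>frob_inner K Q\<bar> \<le> frob_norm K * frob_norm Q" by (rule abs_frob_inner_le[OF K Q])
      also have "\<dots> \<le> frob_norm K * (frob_norm W * h\<^sup>2)"
        by (intro mult_left_mono nQ nn)
      finally show ?thesis by (simp add: mult_ac)
    qed
    have b3: "(frob_norm M)\<^sup>2 \<le> (2 * (frob_norm W * frob_norm X) + frob_norm W)\<^sup>2 * h\<^sup>2"
    proof -
      have L12: "L1 + L2 \<in> carrier_mat ?P ?P" using L1 L2 by auto
      have "frob_norm M \<le> frob_norm L1 + frob_norm L2 + frob_norm Q"
        using frob_norm_triangle[OF L12 Q] frob_norm_triangle[OF L1 L2] by (simp add: M_def)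
      moreover have "h\<^sup>2 \<le> h" using h by (simp add: power2_eq_square mult_left_le)
      then have "frob_norm Q \<le> frob_norm W * h"
        using nQ mult_left_mono[OF _ nn(2), of "h\<^sup>2" h] by simp
      moreover have "frob_norm L1 \<le> frob_norm W * frob_norm X * h"
          "frob_norm L2 \<le> frob_norm W * frob_norm X * h"
        using tri[OF X H] tri[OF H X] by (simp_all add: L1_def L2_def h_def mult_ac)
      ultimately have le: "frob_norm M \<le> (2 * (frob_norm W * frob_norm X) + frob_norm W) * h"
        by (simp add: algebra_simps)
      show ?thesis using power_mono[OF le nn(5), of 2] by (simp only: power_mult_distrib)
    qed
    have "\<bar>f_beta n p A \<beta> (X + H) - f_beta n p A \<beta> X - frob_inner G H\<bar>
        \<le> 1 / 2 * \<bar>frob_inner H (A * H)\<bar> + \<beta> / 2 * \<bar>frob_inner K Q\<bar> + \<beta> / 4 * (frob_norm M)\<^sup>2"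
      unfolding rem using \<open>0 < \<beta>\<close>
      by (intro order_trans[OF abs_triangle_ineq] add_mono) (auto simp: abs_mult)
    also have "\<dots> \<le> 1 / 2 * (frob_norm A * h\<^sup>2) + \<beta> / 2 * (frob_norm K * frob_norm W * h\<^sup>2)
        + \<beta> / 4 * ((2 * (frob_norm W * frob_norm X) + frob_norm W)\<^sup>2 * h\<^sup>2)"
      using b1 b2 b3 \<open>0 < \<beta>\<close> by (intro add_mono mult_left_mono) auto
    also have "\<dots> = C * h\<^sup>2" by (simp add: C_def algebra_simps)
    finally show "\<bar>f_beta n p A \<beta> (X + H) - f_beta n p A \<beta> X - frob_inner G H\<bar>
        \<le> C * (frob_norm H)\<^sup>2" by (simp add: h_def)
  qed
  then show ?thesis by (simp add: G_def V_def K_def W_def J_def)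
qed

lemma f_beta_stationary_iff:
  assumes A: "A \<in> carrier_mat (2 * n) (2 * n)" and sym: "A\<^sup>T = A"
    and X: "X \<in> carrier_mat (2 * n) (2 * p)" and \<beta>: "0 < \<beta>"
  shows "has_mat_gradient (f_beta n p A \<beta>) (0\<^sub>m (2 * n) (2 * p)) X \<longleftrightarrow>
    A * X = \<beta> \<cdot>\<^sub>m (J_mat n * X * (X\<^sup>T * J_mat n * X - J_mat p))"
proof -
  define V where "V = \<beta> \<cdot>\<^sub>m (J_mat n * X * (X\<^sup>T * J_mat n * X - J_mat p))"
  have V: "V \<in> carrier_mat (2 * n) (2 * p)"
    unfolding V_def using X by (intro smult_carrier_mat mult_carrier_mat[of _ _ "2 * p"]
        mult_carrier_mat[of _ _ "2 * n"] minus_carrier_mat) auto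
  have AX: "A * X \<in> carrier_mat (2 * n) (2 * p)" using A X by auto
  have "has_mat_gradient (f_beta n p A \<beta>) (0\<^sub>m (2 * n) (2 * p)) X
      \<longleftrightarrow> A * X - V = 0\<^sub>m (2 * n) (2 * p)"
    using f_beta_has_mat_gradient[OF A sym X \<beta>, folded V_def] has_mat_gradient_unique[OF X] by metis
  also have "\<dots> \<longleftrightarrow> A * X = V"
  proof
    assume eq: "A * X - V = 0\<^sub>m (2 * n) (2 * p)"
    show "A * X = V"
    proof (rule eq_matI)
      fix i j assume ij: "i < dim_row V" "j < dim_col V"
      then have "(A * X - V) $$ (i,j) = 0" using V by (simp add: eq)
      then show "(A * X) $$ (i,j) = V $$ (i,j)" using ij AX by (metis diff_add_cancel add_0 index_minus_mat(1))
    qed (use V AX in auto)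
  qed (use V AX in \<open>auto intro!: eq_matI\<close>)
  finally show ?thesis by (simp add: V_def)
qed

section \<open>Diagonalization of Hermitian matrices\<close>

definition conj_transpose :: "complex mat \<Rightarrow> complex mat" where
  "conj_transpose M = map_mat cnj M\<^sup>T"

lemma conj_transpose_carrier [simp]: "M \<in> carrier_mat r c \<Longrightarrow> conj_transpose M \<in> carrier_mat c r"
  by (simp add: conj_transpose_def)

lemma conj_transpose_index [simp]:
  "i < dim_col M \<Longrightarrow> j < dim_row M \<Longrightarrow> conj_transpose M $$ (i,j) = cnj (M $$ (j,i))"
  "dim_row (conj_transpose M) = dim_col M" "dim_col (conj_transpose M) = dim_row M"
  by (simp_all add: conj_transpose_def)

lemma conj_transpose_conj_transpose [simp]: "conj_transpose (conj_transpose M) = M"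
  by (intro eq_matI) auto

lemma conj_transpose_mult:
  assumes "M \<in> carrier_mat r s" "N \<in> carrier_mat s c"
  shows "conj_transpose (M * N) = conj_transpose N * conj_transpose M"
  using assms by (intro eq_matI) (auto simp: scalar_prod_def mult.commute)

lemma hermitian_congruence:
  assumes U: "U \<in> carrier_mat n m" and H: "H \<in> carrier_mat n n"
  shows "conj_transpose (conj_transpose U * H * U) = conj_transpose U * conj_transpose H * U"
proof -
  have Ua: "conj_transpose U \<in> carrier_mat m n" and Ha: "conj_transpose H \<in> carrier_mat n n"
    using U H by simp_all
  have "conj_transpose (conj_transpose U * H * U) = conj_transpose U * conj_transpose (conj_transpose U * H)"
    using Ua H U by (intro conj_transpose_mult[of _ m n _ m]) auto
  also have "conj_transpose (conj_transpose U * H) = conj_transpose H * U"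
    using conj_transpose_mult[OF Ua H] by simp
  finally show ?thesis using Ua Ha U by (simp add: assoc_mult_mat[of _ m n _ n _ m])
qed

lemma conj_transpose_four_block_diag:
  assumes "M \<in> carrier_mat k k" "N \<in> carrier_mat m m"
  shows "conj_transpose (four_block_mat M (0\<^sub>m k m) (0\<^sub>m m k) N)
    = four_block_mat (conj_transpose M) (0\<^sub>m k m) (0\<^sub>m m k) (conj_transpose N)"
  using assms by (intro eq_matI) auto

lemma mult_four_block_diag:
  assumes "A \<in> carrier_mat k k" "B \<in> carrier_mat m m" "C \<in> carrier_mat k k" "D \<in> carrier_mat m m"
  shows "four_block_mat A (0\<^sub>m k m) (0\<^sub>m m k) B * four_block_mat C (0\<^sub>m k m) (0\<^sub>m m k) D
    = four_block_mat (A * C) (0\<^sub>m k m) (0\<^sub>m m k) (B * D)"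
proof -
  have "A * C \<in> carrier_mat k k" "B * D \<in> carrier_mat m m" using assms by auto
  then show ?thesis
    using assms by (subst mult_four_block_mat[of _ k k _ m _ m _ _ k _ m]) simp_all
qed

text \<open>
Completing \<open>v\<close> to a basis and applying Gram-Schmidt gives orthogonal columns starting with \<open>v\<close>;
these still have to be normalized to make \<open>W\<close> unitary, whence the factor \<open>c\<close>.
\<close>

lemma unitary_extension:
  fixes v :: "complex vec"
  assumes v: "v \<in> carrier_vec n" and v0: "v \<noteq> 0\<^sub>v n"
  obtains W c where "W \<in> carrier_mat n n" "conj_transpose W * W = 1\<^sub>m n" "col W 0 = c \<cdot>\<^sub>v v"
proof -
  interpret cof_vec_space n "TYPE(complex)" .
  have n: "n \<noteq> 0"
  proof
    assume "n = 0"
    then have "v = 0\<^sub>v n" using v by (intro eq_vecI) auto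
    then show False using v0 by simp
  qed
  define b where "b = basis_completion v"
  define ws where "ws = gram_schmidt n b"
  from basis_completion[OF v v0, folded b_def]
  have dist_b: "distinct b" and indep: "\<not> lin_dep (set b)" and b: "set b \<subseteq> carrier_vec n"
    and hdb: "hd b = v" and len_b: "length b = n" by auto
  from hdb len_b n obtain vs where bv: "b = v # vs" by (cases b) auto
  from gram_schmidt_result[OF b dist_b indep refl, folded ws_def]
  have ws: "set ws \<subseteq> carrier_vec n" "corthogonal ws" "length ws = n" by (auto simp: len_b)
  have "hd ws = v" using gram_schmidt_hd[OF v, of vs, folded bv] by (simp add: ws_def)
  then have ws0: "ws ! 0 = v" using ws(3) n by (cases ws) auto
  define a where "a j = Re (ws ! j \<bullet>c ws ! j)" for j
  have wsc: "ws ! j \<in> carrier_vec n" if "j < n" for j using ws that by auto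
  have a: "0 < a j" "ws ! j \<bullet>c ws ! j = complex_of_real (a j)" if "j < n" for j
  proof -
    have ge: "0 \<le> ws ! j \<bullet>c ws ! j" by auto
    then show eq: "ws ! j \<bullet>c ws ! j = complex_of_real (a j)"
      by (simp add: less_eq_complex_def complex_eq_iff a_def)
    have "ws ! j \<bullet>c ws ! j \<noteq> 0" using corthogonalD[OF ws(2), of j j] that ws(3) by simp
    then show "0 < a j" using ge unfolding eq by (simp add: less_eq_complex_def)
  qed
  define W where "W = mat n n (\<lambda>(i,j). ws ! j $ i / complex_of_real (sqrt (a j)))"
  have W: "W \<in> carrier_mat n n" by (simp add: W_def)
  have "conj_transpose W * W = 1\<^sub>m n"
  proof (rule eq_matI)
    fix i j assume "i < dim_row (1\<^sub>m n)" "j < dim_col (1\<^sub>m n)"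
    then have ij: "i < n" "j < n" by auto
    have dims: "dim_vec (ws ! j) = n" "dim_vec (ws ! i) = n" using ij wsc by auto
    have "(conj_transpose W * W) $$ (i,j)
        = (\<Sum>k = 0..<n. cnj (ws ! i $ k / complex_of_real (sqrt (a i))) *
            (ws ! j $ k / complex_of_real (sqrt (a j))))"
      using ij W by (simp add: scalar_prod_def) (simp add: W_def)
    also have "\<dots> = (\<Sum>k = 0..<n. ws ! j $ k * cnj (ws ! i $ k)) /
        (complex_of_real (sqrt (a i)) * complex_of_real (sqrt (a j)))"
      by (simp add: sum_divide_distrib mult_ac)
    also have "(\<Sum>k = 0..<n. ws ! j $ k * cnj (ws ! i $ k)) = ws ! j \<bullet>c ws ! i"
      using ij dims by (simp add: scalar_prod_def)
    also have "\<dots> / (complex_of_real (sqrt (a i)) * complex_of_real (sqrt (a j))) = (if i = j then 1 else 0)"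
    proof (cases "i = j")
      case True
      have "complex_of_real (sqrt (a j)) * complex_of_real (sqrt (a j)) = complex_of_real (a j)"
        using a(1)[OF ij(2)] by (simp flip: of_real_mult)
      then show ?thesis using True a[OF ij(2)] by simp
    next
      case False
      then show ?thesis using corthogonalD[OF ws(2), of j i] ij ws(3) by simp
    qed
    finally show "(conj_transpose W * W) $$ (i,j) = 1\<^sub>m n $$ (i,j)" using ij by simp
  qed (use W in auto)
  moreover have "col W 0 = (1 / complex_of_real (sqrt (a 0))) \<cdot>\<^sub>v v"
    using n v by (intro eq_vecI) (auto simp: W_def ws0)
  ultimately show ?thesis using W that by blast
qed

text \<open>
The spectral theorem, by Schur's deflation: split off one eigenvector with a unitary change of
basis, and continue with the remaining block. The first column of the transformed matrix is a multiple
of the first unit vector, hence so is its first row, by symmetry; this is why diagonal rather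
than triangular form results. The eigenvalues may be listed in any order: this freedom is used
later to place the nonzero ones first.
\<close>

lemma hermitian_diagonalization:
  assumes "H \<in> carrier_mat n n" "conj_transpose H = H" "char_poly H = (\<Prod>e\<leftarrow>es. [:- e, 1:])"
  shows "\<exists>U \<in> carrier_mat n n. conj_transpose U * U = 1\<^sub>m n \<and>
    conj_transpose U * H * U = mat_diag n (\<lambda>i. es ! i)"
  using assms
proof (induction es arbitrary: n H)
  case Nil
  have n: "n = 0" using degree_monic_char_poly[OF Nil(1)] Nil(3) by simp
  show ?case using Nil(1) unfolding n by (intro bexI[of _ "1\<^sub>m 0"] conjI eq_matI) (auto simp: mat_diag_def)
next
  case (Cons e es n H)
  note H = Cons.prems(1)
  let ?r = "\<Prod>e\<leftarrow>es. [:- e, 1:]"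
  have cp: "char_poly H = [:- e, 1:] * ?r" using Cons.prems(3) by simp
  have "degree (char_poly H) = Suc (degree ?r)"
  proof -
    have "monic ?r" by (rule monic_prod_list) auto
    then have "?r \<noteq> 0" by auto
    then show ?thesis unfolding cp by (subst degree_mult_eq) auto
  qed
  then obtain m where n: "n = Suc m" using degree_monic_char_poly[OF H] by auto
  have "eigenvalue H e" unfolding eigenvalue_root_char_poly[OF H] cp by simp
  from find_eigenvector[OF H this] obtain v where "eigenvector H v e" by blast
  then have v: "v \<in> carrier_vec n" "v \<noteq> 0\<^sub>v n" and ev: "H *\<^sub>v v = e \<cdot>\<^sub>v v"
    using H by (auto simp: eigenvector_def)
  obtain W c where W: "W \<in> carrier_mat n n" and uW: "conj_transpose W * W = 1\<^sub>m n"
    and W0: "col W 0 = c \<cdot>\<^sub>v v"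
    using unitary_extension[OF v] by blast
  have Wa: "conj_transpose W \<in> carrier_mat n n" using W by simp
  have uW': "W * conj_transpose W = 1\<^sub>m n" by (rule mat_mult_left_right_inverse[OF Wa W uW])
  define B where "B = conj_transpose W * H * W"
  have B: "B \<in> carrier_mat n n" using W H by (auto simp: B_def)
  have Bh: "conj_transpose B = B"
    using hermitian_congruence[OF W H] Cons.prems(2) by (simp add: B_def)
  have col0: "B $$ (i,0) = (if i = 0 then e else 0)" if "i < n" for i
  proof -
    have cW: "col W 0 \<in> carrier_vec n" using v by (simp add: W0)
    have "conj_transpose W * H \<in> carrier_mat n n" using Wa H by auto
    then have "col B 0 = conj_transpose W * H *\<^sub>v col W 0"
      using W n unfolding B_def by (intro col_mult2[of _ n n _ n]) auto
    also have "\<dots> = conj_transpose W *\<^sub>v (H *\<^sub>v col W 0)"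
      by (rule assoc_mult_mat_vec[OF Wa H cW])
    also have "H *\<^sub>v col W 0 = e \<cdot>\<^sub>v col W 0"
      using H v by (simp add: W0 mult_mat_vec[of H n n] ev smult_smult_assoc mult.commute)
    also have "conj_transpose W *\<^sub>v (e \<cdot>\<^sub>v col W 0) = e \<cdot>\<^sub>v (conj_transpose W *\<^sub>v col W 0)"
      using Wa W by (intro mult_mat_vec[of _ n n]) auto
    also have "conj_transpose W *\<^sub>v col W 0 = col (conj_transpose W * W) 0"
      using Wa W n by (subst col_mult2[of _ n n _ n]) auto
    also have "\<dots> = unit_vec n 0" using n by (simp add: uW)
    finally have "col B 0 $ i = (e \<cdot>\<^sub>v unit_vec n 0) $ i" by simp
    then show ?thesis using that n B by simp
  qed
  define C where "C = mat m m (\<lambda>(i,j). B $$ (Suc i, Suc j))"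
  have C: "C \<in> carrier_mat m m" by (simp add: C_def)
  define E where "E = mat 1 1 (\<lambda>_. e)"
  have E: "E \<in> carrier_mat 1 1" by (simp add: E_def)
  have E00: "E $$ (0,0) = e" by (simp add: E_def)
  have BC: "B = four_block_mat E (0\<^sub>m 1 m) (0\<^sub>m m 1) C"
  proof (rule eq_matI)
    fix i j
    assume "i < dim_row (four_block_mat E (0\<^sub>m 1 m) (0\<^sub>m m 1) C)"
      "j < dim_col (four_block_mat E (0\<^sub>m 1 m) (0\<^sub>m m 1) C)"
    then have ij: "i < n" "j < n" using E C n by auto
    have row0: "B $$ (0,j) = 0" if "0 < j"
    proof -
      have "B $$ (0,j) = cnj (B $$ (j,0))"
        using arg_cong[OF Bh, of "\<lambda>M. M $$ (0,j)"] B ij n by simp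
      then show ?thesis using col0[OF ij(2)] that by simp
    qed
    show "B $$ (i,j) = four_block_mat E (0\<^sub>m 1 m) (0\<^sub>m m 1) C $$ (i,j)"
      using ij n E C col0[OF ij(1)] row0 by (auto simp: E_def C_def)
  qed (use B E C n in auto)
  have Ch: "conj_transpose C = C"
  proof (rule eq_matI)
    fix i j assume "i < dim_row C" "j < dim_col C"
    then have ij: "i < m" "j < m" using C by auto
    have "B $$ (Suc i, Suc j) = cnj (B $$ (Suc j, Suc i))"
      using arg_cong[OF Bh, of "\<lambda>M. M $$ (Suc i, Suc j)"] B ij n by simp
    then show "conj_transpose C $$ (i,j) = C $$ (i,j)" using ij by (simp add: C_def)
  qed (use C in auto)
  have cpC: "char_poly C = ?r"
  proof -
    have "similar_mat_wit B H (conj_transpose W) W"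
      by (rule similar_mat_witI[of _ _ n]) (use W Wa H B uW uW' in \<open>auto simp: B_def\<close>)
    then have "char_poly B = char_poly H"
      by (intro char_poly_similar) (auto simp: similar_mat_def)
    also have "char_poly B = char_poly E * char_poly C"
      unfolding BC by (rule char_poly_four_block_zeros_col[OF E _ C]) auto
    also have "char_poly E = [:- e, 1:]"
      by (simp add: E_def char_poly_defs det_def sign_def)
    finally show ?thesis unfolding cp
      by (metis mult_cancel_left pCons_eq_0_iff zero_neq_one)
  qed
  obtain U where U: "U \<in> carrier_mat m m" "conj_transpose U * U = 1\<^sub>m m"
    "conj_transpose U * C * U = mat_diag m (\<lambda>i. es ! i)"
    using Cons.IH[OF C Ch cpC] by blast
  define F where "F = four_block_mat (1\<^sub>m 1) (0\<^sub>m 1 m) (0\<^sub>m m 1) U"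
  have adj1: "conj_transpose (1\<^sub>m 1) = 1\<^sub>m 1" by (intro eq_matI) auto
  have F: "F \<in> carrier_mat n n" using U by (auto simp: F_def n intro!: carrier_matI)
  have Fa: "conj_transpose F = four_block_mat (1\<^sub>m 1) (0\<^sub>m 1 m) (0\<^sub>m m 1) (conj_transpose U)"
    unfolding F_def conj_transpose_four_block_diag[OF one_carrier_mat U(1)] adj1 ..
  have Fac: "conj_transpose F \<in> carrier_mat n n" using F by simp
  have Ua: "conj_transpose U \<in> carrier_mat m m" using U by simp
  have UC: "conj_transpose U * C \<in> carrier_mat m m" using Ua C by auto
  have uF: "conj_transpose F * F = 1\<^sub>m n"
    unfolding Fa unfolding F_def mult_four_block_diag[OF one_carrier_mat Ua one_carrier_mat U(1)]
    by (simp add: U(2) n)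
  have dF: "conj_transpose F * B * F = mat_diag n (\<lambda>i. (e # es) ! i)"
  proof -
    have "conj_transpose F * B * F = four_block_mat (1\<^sub>m 1 * E * 1\<^sub>m 1) (0\<^sub>m 1 m) (0\<^sub>m m 1) (conj_transpose U * C * U)"
      unfolding Fa BC unfolding F_def mult_four_block_diag[OF one_carrier_mat Ua E C]
      by (rule mult_four_block_diag[OF _ UC one_carrier_mat U(1)]) (use E in auto)
    also have "1\<^sub>m 1 * E * 1\<^sub>m 1 = E"
      using E by (simp only: left_mult_one_mat[OF E] right_mult_one_mat[OF E])
    also have "four_block_mat E (0\<^sub>m 1 m) (0\<^sub>m m 1) (conj_transpose U * C * U) = mat_diag n (\<lambda>i. (e # es) ! i)"
      unfolding U(3) using n carrier_matD[OF E] E00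
      by (intro eq_matI) (auto simp: mat_diag_def nth_Cons')
    finally show ?thesis .
  qed
  show ?case
  proof (intro bexI[of _ "W * F"] conjI)
    show "W * F \<in> carrier_mat n n" using W F by auto
    have adjWF: "conj_transpose (W * F) = conj_transpose F * conj_transpose W" by (rule conj_transpose_mult[OF W F])
    have "conj_transpose F * conj_transpose W * (W * F) = conj_transpose F * (conj_transpose W * W) * F"
      using W Wa F Fac by (simp add: assoc_mult_mat[of _ n n _ n _ n] mult_carrier_mat[of _ n n _ n])
    then show "conj_transpose (W * F) * (W * F) = 1\<^sub>m n" unfolding adjWF by (simp only: uW right_mult_one_mat[OF Fac] uF)
    have "conj_transpose F * conj_transpose W * H * (W * F) = conj_transpose F * B * F"
      using W Wa F Fac H unfolding B_def by (simp add: assoc_mult_mat[of _ n n _ n _ n] mult_carrier_mat[of _ n n _ n])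
    then show "conj_transpose (W * F) * H * (W * F) = mat_diag n (\<lambda>i. (e # es) ! i)"
      unfolding adjWF dF .
  qed
qed

section \<open>Orthosymplectic diagonalization\<close>

text \<open>
A one-sided inverse of a square matrix is two-sided; with \<open>T T\<^sup>T = 1\<close>, both defining equations can be
conjugated by \<open>T\<close>.
\<close>
lemma OrSp_transpose:
  assumes "T \<in> OrSp p"
  shows "T\<^sup>T \<in> OrSp p" "T * T\<^sup>T = 1\<^sub>m (2 * p)"
proof -
  have T: "T \<in> carrier_mat (2 * p) (2 * p)" and o: "T\<^sup>T * T = 1\<^sub>m (2 * p)"
    and s: "T\<^sup>T * J_mat p * T = J_mat p" using assms by (auto simp: OrSp_def)
  have Tt: "T\<^sup>T \<in> carrier_mat (2 * p) (2 * p)" using T by simp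
  show o': "T * T\<^sup>T = 1\<^sub>m (2 * p)" by (rule mat_mult_left_right_inverse[OF Tt T o])
  have TtJ: "T\<^sup>T * J_mat p \<in> carrier_mat (2 * p) (2 * p)" by (rule mult_carrier_mat[OF Tt J_mat_carrier])
  have "T\<^sup>T * J_mat p = T\<^sup>T * J_mat p * (T * T\<^sup>T)" using TtJ by (simp add: o')
  also have "\<dots> = T\<^sup>T * J_mat p * T * T\<^sup>T" by (rule assoc_mult_mat[symmetric, OF TtJ T Tt])
  finally have c: "T\<^sup>T * J_mat p = J_mat p * T\<^sup>T" by (simp only: s)
  have "T * J_mat p * T\<^sup>T = T * (J_mat p * T\<^sup>T)" by (rule assoc_mult_mat[OF T J_mat_carrier Tt])
  also have "\<dots> = T * T\<^sup>T * J_mat p"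
    unfolding c[symmetric] by (rule assoc_mult_mat[symmetric, OF T Tt J_mat_carrier])
  also have "\<dots> = J_mat p" by (simp add: o')
  finally show "T\<^sup>T \<in> OrSp p" using Tt by (simp add: OrSp_def o')
qed

lemma OrSp_commute_J_mat:
  assumes "T \<in> OrSp p"
  shows "T\<^sup>T * J_mat p = J_mat p * T\<^sup>T"
proof -
  have T: "T \<in> carrier_mat (2 * p) (2 * p)" and s: "T\<^sup>T * J_mat p * T = J_mat p"
    using assms by (auto simp: OrSp_def)
  have Tt: "T\<^sup>T \<in> carrier_mat (2 * p) (2 * p)" using T by simp
  have TtJ: "T\<^sup>T * J_mat p \<in> carrier_mat (2 * p) (2 * p)" by (rule mult_carrier_mat[OF Tt J_mat_carrier])
  have "T\<^sup>T * J_mat p = T\<^sup>T * J_mat p * (T * T\<^sup>T)" using TtJ by (simp add: OrSp_transpose(2)[OF assms])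
  also have "\<dots> = T\<^sup>T * J_mat p * T * T\<^sup>T" by (rule assoc_mult_mat[symmetric, OF TtJ T Tt])
  finally show ?thesis by (simp only: s)
qed

text \<open>
The embedding of complex matrices into real matrices of twice the size. It turns products into
products, adjoints into transposes and \<open>\<i>\<close> into \<open>J_mat\<close>, and its image among the square matrices
consists of the matrices that commute with \<open>J_mat\<close>.
\<close>

definition realify :: "complex mat \<Rightarrow> real mat" where
  "realify Z = four_block_mat (map_mat Re Z) (map_mat Im Z) (- map_mat Im Z) (map_mat Re Z)"

lemma realify_carrier [simp]: "Z \<in> carrier_mat r c \<Longrightarrow> realify Z \<in> carrier_mat (2 * r) (2 * c)"
  by (auto simp: realify_def intro!: carrier_matI)

lemma dim_realify [simp]:
  "dim_row (realify Z) = 2 * dim_row Z" "dim_col (realify Z) = 2 * dim_col Z"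
  by (simp_all add: realify_def)

lemma realify_index:
  assumes "Z \<in> carrier_mat r c" "i < r" "j < c"
  shows "realify Z $$ (i,j) = Re (Z $$ (i,j))" "realify Z $$ (i,c + j) = Im (Z $$ (i,j))"
    "realify Z $$ (r + i,j) = - Im (Z $$ (i,j))" "realify Z $$ (r + i,c + j) = Re (Z $$ (i,j))"
  using assms by (auto simp: realify_def)

lemma mat_eq_by_halvesI:
  assumes "M \<in> carrier_mat (2 * r) (2 * c)" "N \<in> carrier_mat (2 * r) (2 * c)"
    and "\<And>i j. i < r \<Longrightarrow> j < c \<Longrightarrow> M $$ (i,j) = N $$ (i,j) \<and> M $$ (i,c + j) = N $$ (i,c + j) \<and>
      M $$ (r + i,j) = N $$ (r + i,j) \<and> M $$ (r + i,c + j) = N $$ (r + i,c + j)"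
  shows "M = N"
proof (rule eq_matI)
  fix i j assume "i < dim_row N" "j < dim_col N"
  then have ij: "i < 2 * r" "j < 2 * c" using assms(2) by auto
  show "M $$ (i,j) = N $$ (i,j)"
  proof (cases "i < r"; cases "j < c")
    assume "\<not> i < r" "\<not> j < c"
    then show ?thesis using assms(3)[of "i - r" "j - c"] ij by simp
  next
    assume "\<not> i < r" "j < c"
    then show ?thesis using assms(3)[of "i - r" j] ij by simp
  next
    assume "i < r" "\<not> j < c"
    then show ?thesis using assms(3)[of i "j - c"] ij by simp
  qed (use assms(3) in auto)
qed (use assms in auto)

lemma realify_mult:
  assumes Z: "Z \<in> carrier_mat r s" and W: "W \<in> carrier_mat s c"
  shows "realify (Z * W) = realify Z * realify W"
proof -
  let ?RZ = "map_mat Re Z" and ?IZ = "map_mat Im Z" and ?RW = "map_mat Re W" and ?IW = "map_mat Im W"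
  have "realify Z * realify W = four_block_mat
      (?RZ * ?RW + ?IZ * (- ?IW)) (?RZ * ?IW + ?IZ * ?RW)
      (- ?IZ * ?RW + ?RZ * (- ?IW)) (- ?IZ * ?IW + ?RZ * ?RW)"
    unfolding realify_def
    using Z W by (intro mult_four_block_mat[of _ r s _ s _ r _ _ c _ c]) auto
  also have "?RZ * ?RW + ?IZ * (- ?IW) = map_mat Re (Z * W)"
    using Z W by (intro eq_matI) (auto simp: scalar_prod_def sum_subtractf)
  also have "?RZ * ?IW + ?IZ * ?RW = map_mat Im (Z * W)"
    using Z W by (intro eq_matI) (auto simp: scalar_prod_def sum.distrib)
  also have "- ?IZ * ?RW + ?RZ * (- ?IW) = - map_mat Im (Z * W)"
    using Z W by (intro eq_matI) (auto simp: scalar_prod_def sum.distrib)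
  also have "- ?IZ * ?IW + ?RZ * ?RW = map_mat Re (Z * W)"
    using Z W by (intro eq_matI) (auto simp: scalar_prod_def sum_subtractf)
  finally show ?thesis by (simp add: realify_def)
qed

lemma realify_conj_transpose:
  assumes "Z \<in> carrier_mat r c"
  shows "realify (conj_transpose Z) = (realify Z)\<^sup>T"
  by (rule mat_eq_by_halvesI[of _ c r])
    (use assms in \<open>auto simp: realify_index[of _ c r] realify_index[OF assms]\<close>)

lemma realify_mat_diag:
  "realify (mat_diag p (\<lambda>i. complex_of_real (e i))) = mat_diag (2 * p) (\<lambda>i. e (i mod p))"
  by (rule mat_eq_by_halvesI[of _ p p])
    (auto simp: realify_index[OF mat_diag_dim], auto simp: mat_diag_def)

lemma realify_one: "realify (1\<^sub>m p) = 1\<^sub>m (2 * p)"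
  using realify_mat_diag[of p "\<lambda>_. 1"] by simp

lemma realify_imaginary_unit: "realify (\<i> \<cdot>\<^sub>m 1\<^sub>m p) = J_mat p"
  by (rule mat_eq_by_halvesI[of _ p p]) (auto simp: realify_index[of _ p p] J_mat_index)

lemma J_mat_square: "J_mat p * J_mat p = - 1\<^sub>m (2 * p)"
proof -
  have "J_mat p * J_mat p = realify ((\<i> \<cdot>\<^sub>m 1\<^sub>m p) * (\<i> \<cdot>\<^sub>m 1\<^sub>m p))"
    by (subst realify_mult[of _ p p _ p]) (simp_all add: realify_imaginary_unit)
  also have "\<i> \<cdot>\<^sub>m 1\<^sub>m p = mat_diag p (\<lambda>_. \<i>)"
    by (intro eq_matI) (auto simp: mat_diag_def)
  also have "mat_diag p (\<lambda>_. \<i>) * mat_diag p (\<lambda>_. \<i>) = mat_diag p (\<lambda>i. complex_of_real (- 1))"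
    by simp
  also have "realify \<dots> = mat_diag (2 * p) (\<lambda>i. - 1)" by (rule realify_mat_diag)
  also have "\<dots> = - 1\<^sub>m (2 * p)" by (intro eq_matI) (auto simp: mat_diag_def)
  finally show ?thesis .
qed

lemma realify_unitary_in_OrSp:
  assumes U: "U \<in> carrier_mat p p" and u: "conj_transpose U * U = 1\<^sub>m p"
  shows "realify U \<in> OrSp p"
proof -
  let ?T = "realify U" and ?I = "\<i> \<cdot>\<^sub>m 1\<^sub>m p"
  have T: "?T \<in> carrier_mat (2 * p) (2 * p)" using U by simp
  have o: "?T\<^sup>T * ?T = 1\<^sub>m (2 * p)"
    using U by (simp add: realify_conj_transpose[symmetric] realify_mult[of _ p p _ p, symmetric] u realify_one)
  have "J_mat p * ?T = realify (?I * U)"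
    using U by (simp add: realify_mult[of _ p p _ p] realify_imaginary_unit)
  also have "?I * U = U * ?I" using U by (intro eq_matI) auto
  also have "realify (U * ?I) = ?T * J_mat p"
    using U by (simp add: realify_mult[of _ p p _ p] realify_imaginary_unit)
  finally have comm: "J_mat p * ?T = ?T * J_mat p" .
  have "?T\<^sup>T * J_mat p * ?T = (?T\<^sup>T * ?T) * J_mat p"
    using T by (simp add: assoc_mult_mat[of _ "2 * p" "2 * p" _ "2 * p" _ "2 * p"] comm)
  also have "\<dots> = J_mat p" by (simp add: o)
  finally show ?thesis using T o by (simp add: OrSp_def)
qed

lemma J_mat_mult_index:
  assumes N: "N \<in> carrier_mat (2 * p) c" and "i < p" "j < c"
  shows "(J_mat p * N) $$ (i,j) = N $$ (p + i,j)" "(J_mat p * N) $$ (p + i,j) = - N $$ (i,j)"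
proof -
  have "(J_mat p * N) $$ (i,j) = (\<Sum>k = 0..<2*p. J_mat p $$ (i,k) * N $$ (k,j))"
    using assms by (simp add: scalar_prod_def)
  also have "\<dots> = (\<Sum>k = 0..<2*p. (if k = p + i then N $$ (p + i, j) else 0))"
    using assms by (intro sum.cong refl) (auto simp: J_mat_index add.commute)
  also have "\<dots> = N $$ (p + i,j)" using assms by simp
  finally show "(J_mat p * N) $$ (i,j) = N $$ (p + i,j)" .
  have "(J_mat p * N) $$ (p + i,j) = (\<Sum>k = 0..<2*p. J_mat p $$ (p + i,k) * N $$ (k,j))"
    using assms by (simp add: scalar_prod_def)
  also have "\<dots> = (\<Sum>k = 0..<2*p. (if k = i then - N $$ (i, j) else 0))"
    using assms by (intro sum.cong refl) (auto simp: J_mat_index add.commute)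
  also have "\<dots> = - N $$ (i,j)" using assms by simp
  finally show "(J_mat p * N) $$ (p + i,j) = - N $$ (i,j)" .
qed

lemma mult_J_mat_index:
  assumes N: "N \<in> carrier_mat r (2 * p)" and "i < r" "j < p"
  shows "(N * J_mat p) $$ (i,j) = - N $$ (i,p + j)" "(N * J_mat p) $$ (i,p + j) = N $$ (i,j)"
proof -
  have "(N * J_mat p) $$ (i,j) = (\<Sum>k = 0..<2*p. N $$ (i,k) * J_mat p $$ (k,j))"
    using assms by (simp add: scalar_prod_def)
  also have "\<dots> = (\<Sum>k = 0..<2*p. (if k = p + j then - N $$ (i, p + j) else 0))"
    using assms by (intro sum.cong refl) (auto simp: J_mat_index add.commute)
  also have "\<dots> = - N $$ (i,p + j)" using assms by simp
  finally show "(N * J_mat p) $$ (i,j) = - N $$ (i,p + j)" .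
  have "(N * J_mat p) $$ (i,p + j) = (\<Sum>k = 0..<2*p. N $$ (i,k) * J_mat p $$ (k,p + j))"
    using assms by (simp add: scalar_prod_def)
  also have "\<dots> = (\<Sum>k = 0..<2*p. (if k = j then N $$ (i, j) else 0))"
    using assms by (intro sum.cong refl) (auto simp: J_mat_index add.commute)
  also have "\<dots> = N $$ (i,j)" using assms by simp
  finally show "(N * J_mat p) $$ (i,p + j) = N $$ (i,j)" .
qed

text \<open>
Commuting with \<open>J_mat\<close> determines the lower blocks of a matrix by the upper ones.
\<close>

lemma commuting_J_mat_imp_realify:
  assumes N: "N \<in> carrier_mat (2 * p) (2 * p)" and comm: "J_mat p * N = N * J_mat p"
  shows "N = realify (mat p p (\<lambda>(i,j). Complex (N $$ (i,j)) (N $$ (i,p + j))))"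
proof (rule mat_eq_by_halvesI[of _ p p])
  fix i j assume ij: "i < p" "j < p"
  have "N $$ (p + i,j) = (J_mat p * N) $$ (i,j)" using ij by (simp add: J_mat_mult_index[OF N])
  also have "\<dots> = - N $$ (i,p + j)" unfolding comm using ij by (simp add: mult_J_mat_index[OF N])
  finally have 1: "N $$ (p + i,j) = - N $$ (i,p + j)" .
  have "N $$ (p + i,p + j) = (J_mat p * N) $$ (i,p + j)" using ij by (simp add: J_mat_mult_index[OF N])
  also have "\<dots> = N $$ (i,j)" unfolding comm using ij by (simp add: mult_J_mat_index[OF N])
  finally have 2: "N $$ (p + i,p + j) = N $$ (i,j)" .
  show "N $$ (i,j) = realify (mat p p (\<lambda>(i,j). Complex (N $$ (i,j)) (N $$ (i,p + j)))) $$ (i,j) \<and>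
    N $$ (i,p + j) = realify (mat p p (\<lambda>(i,j). Complex (N $$ (i,j)) (N $$ (i,p + j)))) $$ (i,p + j) \<and>
    N $$ (p + i,j) = realify (mat p p (\<lambda>(i,j). Complex (N $$ (i,j)) (N $$ (i,p + j)))) $$ (p + i,j) \<and>
    N $$ (p + i,p + j) = realify (mat p p (\<lambda>(i,j). Complex (N $$ (i,j)) (N $$ (i,p + j)))) $$ (p + i,p + j)"
    using ij 1 2 by (simp add: realify_index[of _ p p])
qed (use N in auto)

text \<open>
Under \<open>realify\<close>, \<open>N\<close> comes from a Hermitian matrix and unitary matrices become orthosymplectic, so this
is the complex spectral theorem. The entries of the diagonal are real because the diagonalized
matrix is Hermitian as well.
\<close>

lemma orthosymplectic_diagonalization:
  assumes N: "N \<in> carrier_mat (2 * p) (2 * p)" and sym: "N\<^sup>T = N"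
    and comm: "J_mat p * N = N * J_mat p"
  obtains T e q where "T \<in> OrSp p" "q \<le> p" "\<And>i. i < q \<Longrightarrow> e i \<noteq> 0"
    "\<And>i. q \<le> i \<Longrightarrow> i < p \<Longrightarrow> e i = 0" "T\<^sup>T * N * T = mat_diag (2 * p) (\<lambda>i. e (i mod p))"
proof -
  define H where "H = mat p p (\<lambda>(i,j). Complex (N $$ (i,j)) (N $$ (i,p + j)))"
  have H: "H \<in> carrier_mat p p" by (simp add: H_def)
  have NH: "N = realify H" unfolding H_def by (rule commuting_J_mat_imp_realify[OF N comm])
  have Hh: "conj_transpose H = H"
  proof (rule eq_matI)
    fix i j assume "i < dim_row H" "j < dim_col H"
    then have ij: "i < p" "j < p" using H by auto
    have "realify (conj_transpose H) = realify H"
      using sym H by (simp add: NH realify_conj_transpose)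
    then have "realify (conj_transpose H) $$ (i,k) = realify H $$ (i,k)" for k by simp
    from this[of j] this[of "p + j"] show "conj_transpose H $$ (i,j) = H $$ (i,j)"
      using ij H realify_index[OF H ij] realify_index[OF conj_transpose_carrier[OF H] ij]
      by (simp add: complex_eq_iff)
  qed (use H in auto)
  obtain as where as: "char_poly H = (\<Prod>a\<leftarrow>as. [:- a, 1:])" "length as = p"
    using char_poly_factorized[OF H] by blast
  \<comment> \<open>Reordering the eigenvalues so that the nonzero ones come first.\<close>
  define nz where "nz = filter (\<lambda>a. a \<noteq> 0) as"
  define es where "es = nz @ filter (\<lambda>a. a = 0) as"
  define q where "q = length nz"
  have "(\<Prod>a\<leftarrow>es. [:- a, 1:]) = (\<Prod>a\<leftarrow>as. [:- a, 1:])"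
    unfolding es_def nz_def
    by (induction as) (simp_all add: mult_ac del: mult_pCons_left mult_pCons_right)
  then have cp: "char_poly H = (\<Prod>a\<leftarrow>es. [:- a, 1:])" using as by simp
  have len: "length es = p"
    unfolding es_def nz_def using as(2) by (simp add: sum_length_filter_compl[of "\<lambda>a. a \<noteq> 0" as, simplified])
  have q: "q \<le> p" using len by (simp add: es_def q_def)
  obtain U where U: "U \<in> carrier_mat p p" "conj_transpose U * U = 1\<^sub>m p"
    "conj_transpose U * H * U = mat_diag p (\<lambda>i. es ! i)"
    using hermitian_diagonalization[OF H Hh cp] by blast
  have real: "es ! i = complex_of_real (Re (es ! i))" if "i < p" for i
  proof -
    have "conj_transpose (conj_transpose U * H * U) = conj_transpose U * H * U"
      using hermitian_congruence[OF U(1) H] by (simp add: Hh)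
    then have "conj_transpose (mat_diag p (\<lambda>i. es ! i)) $$ (i,i) = mat_diag p (\<lambda>i. es ! i) $$ (i,i)"
      by (simp add: U(3))
    then have "cnj (es ! i) = es ! i" using that by (simp add: mat_diag_def)
    then show ?thesis by (simp add: complex_eq_iff)
  qed
  define e where "e i = Re (es ! i)" for i
  have diag: "mat_diag p (\<lambda>i. es ! i) = mat_diag p (\<lambda>i. complex_of_real (e i))"
    using real by (intro eq_matI) (auto simp: mat_diag_def e_def)
  show ?thesis
  proof (rule that[of "realify U" q e])
    show "realify U \<in> OrSp p" by (rule realify_unitary_in_OrSp[OF U(1,2)])
    show "q \<le> p" by (rule q)
    show "e i \<noteq> 0" if "i < q" for i
    proof -
      have "es ! i \<in> set nz" using that by (simp add: es_def nth_append q_def)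
      then have "es ! i \<noteq> 0" by (simp add: nz_def)
      then show ?thesis using real[of i] that q by (auto simp: e_def)
    qed
    show "e i = 0" if "q \<le> i" "i < p" for i
    proof -
      have "es ! i = filter (\<lambda>a. a = 0) as ! (i - q)" using that by (simp add: es_def nth_append q_def)
      also have "\<dots> \<in> set (filter (\<lambda>a. a = 0) as)"
        using that len by (intro nth_mem) (simp add: es_def q_def)
      finally show ?thesis by (simp add: e_def)
    qed
    have "conj_transpose U * H \<in> carrier_mat p p" using U(1) H by auto
    then have "(realify U)\<^sup>T * N * realify U = realify (conj_transpose U * H * U)"
      using U(1) H by (simp add: NH realify_conj_transpose[symmetric] realify_mult[of _ p p _ p, symmetric])
    then show "(realify U)\<^sup>T * N * realify U = mat_diag (2 * p) (\<lambda>i. e (i mod p))"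
      by (simp add: U(3) diag realify_mat_diag)
  qed
qed

section \<open>Scaled symplectic frames\<close>

text \<open>
Rectangular diagonal matrices acting in the same way on both halves of the columns. Multiplying
by them from the right scales the column pairs, and at the same time drops surplus pairs or adds
zero pairs; since they are realified, they commute with \<open>J_mat\<close>.
\<close>

definition pair_diag :: "nat \<Rightarrow> nat \<Rightarrow> (nat \<Rightarrow> real) \<Rightarrow> real mat" where
  "pair_diag k l c = realify (mat k l (\<lambda>(i,j). if i = j then complex_of_real (c i) else 0))"

lemma pair_diag_carrier [simp]: "pair_diag k l c \<in> carrier_mat (2 * k) (2 * l)"
  by (simp add: pair_diag_def)

lemma dim_pair_diag [simp]: "dim_row (pair_diag k l c) = 2 * k" "dim_col (pair_diag k l c) = 2 * l"
  by (simp_all add: pair_diag_def)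

lemma pair_diag_cong:
  "(\<And>i. i < k \<Longrightarrow> i < l \<Longrightarrow> c i = c' i) \<Longrightarrow> pair_diag k l c = pair_diag k l c'"
  unfolding pair_diag_def by (intro arg_cong[where f = realify] cong_mat) auto

lemma pair_diag_square: "pair_diag k k c = mat_diag (2 * k) (\<lambda>i. c (i mod k))"
proof -
  have "mat k k (\<lambda>(i,j). if i = j then complex_of_real (c i) else 0)
      = mat_diag k (\<lambda>i. complex_of_real (c i))"
    by (auto simp: mat_diag_def)
  then show ?thesis by (simp add: pair_diag_def realify_mat_diag)
qed

lemma pair_diag_one: "pair_diag k k (\<lambda>_. 1) = 1\<^sub>m (2 * k)"
  by (simp add: pair_diag_square)

lemma transpose_pair_diag: "(pair_diag k l c)\<^sup>T = pair_diag l k c"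
proof -
  have "conj_transpose (mat k l (\<lambda>(i,j). if i = j then complex_of_real (c i) else 0))
      = mat l k (\<lambda>(i,j). if i = j then complex_of_real (c i) else 0)"
    by (intro eq_matI) auto
  then show ?thesis
    by (simp add: pair_diag_def realify_conj_transpose[of _ k l, symmetric])
qed

lemma pair_diag_mult:
  "pair_diag k l c * pair_diag l m c' = pair_diag k m (\<lambda>i. if i < l then c i * c' i else 0)"
proof -
  let ?P = "\<lambda>k l c. mat k l (\<lambda>(i,j). if i = j then complex_of_real (c i) else 0)"
  have "?P k l c * ?P l m c' = ?P k m (\<lambda>i. if i < l then c i * c' i else 0)"
  proof (rule eq_matI)
    fix i j assume "i < dim_row (?P k m (\<lambda>i. if i < l then c i * c' i else 0))"
      "j < dim_col (?P k m (\<lambda>i. if i < l then c i * c' i else 0))"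
    then have ij: "i < k" "j < m" by auto
    have "(?P k l c * ?P l m c') $$ (i,j) = (\<Sum>h = 0..<l. ?P k l c $$ (i,h) * ?P l m c' $$ (h,j))"
      using ij by (simp add: scalar_prod_def)
    also have "\<dots> = (\<Sum>h = 0..<l. (if h = i then
        (if i = j then complex_of_real (c i * c' i) else 0) else 0))"
      using ij by (intro sum.cong refl) auto
    also have "\<dots> = ?P k m (\<lambda>i. if i < l then c i * c' i else 0) $$ (i,j)" using ij by auto
    finally show "(?P k l c * ?P l m c') $$ (i,j) = \<dots>" .
  qed auto
  then show ?thesis by (simp add: pair_diag_def realify_mult[of _ k l _ m, symmetric])
qed

lemma J_mat_pair_diag_commute: "J_mat k * pair_diag k l c = pair_diag k l c * J_mat l"
proof -
  let ?P = "mat k l (\<lambda>(i,j). if i = j then complex_of_real (c i) else 0)"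
  have "J_mat k * pair_diag k l c = realify ((\<i> \<cdot>\<^sub>m 1\<^sub>m k) * ?P)"
    by (simp add: pair_diag_def realify_mult[of _ k k _ l] realify_imaginary_unit)
  also have "(\<i> \<cdot>\<^sub>m 1\<^sub>m k) * ?P = ?P * (\<i> \<cdot>\<^sub>m 1\<^sub>m l)" by (intro eq_matI) auto
  also have "realify \<dots> = pair_diag k l c * J_mat l"
    by (simp add: pair_diag_def realify_mult[of _ k l _ l] realify_imaginary_unit)
  finally show ?thesis .
qed

lemma transpose_J_mat_pair_diag_commute:
  "(J_mat k)\<^sup>T * pair_diag k l c = pair_diag k l c * (J_mat l)\<^sup>T"
  by (simp add: transpose_J_mat J_mat_pair_diag_commute)


lemma mult_pair_diag_index:
  assumes M: "M \<in> carrier_mat r (2 * k)" and ij: "i < r" "j < l"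
  shows "(M * pair_diag k l c) $$ (i,j) = (if j < k then M $$ (i,j) * c j else 0)"
    "(M * pair_diag k l c) $$ (i,l + j) = (if j < k then M $$ (i,k + j) * c j else 0)"
proof -
  let ?P = "mat k l (\<lambda>(i,j). if i = j then complex_of_real (c i) else 0)"
  have P: "?P \<in> carrier_mat k l" by simp
  have halves: "(\<Sum>h = 0..<2 * k. f h) = (\<Sum>h<k. f h + f (k + h))" for f :: "nat \<Rightarrow> real"
  proof -
    have "(\<Sum>h = 0..<2 * k. f h) = (\<Sum>h = 0..<k. f h) + (\<Sum>h = k..<k + k. f h)"
      by (simp add: sum.atLeastLessThan_concat mult_2)
    also have "(\<Sum>h = k..<k + k. f h) = (\<Sum>h = 0..<k. f (k + h))"
      using sum.shift_bounds_nat_ivl[of f 0 k k] by (simp add: add.commute)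
    finally show ?thesis by (simp add: sum.distrib atLeast0LessThan)
  qed
  have "(M * pair_diag k l c) $$ (i,j) = (\<Sum>h = 0..<2 * k. M $$ (i,h) * pair_diag k l c $$ (h,j))"
    using M ij by (simp add: scalar_prod_def)
  also have "\<dots> = (\<Sum>h<k. (if h = j then M $$ (i,j) * c j else 0))"
    unfolding halves using ij
    by (intro sum.cong refl) (auto simp: pair_diag_def realify_index[OF P])
  finally show "(M * pair_diag k l c) $$ (i,j) = (if j < k then M $$ (i,j) * c j else 0)" by simp
  have "(M * pair_diag k l c) $$ (i,l + j) = (\<Sum>h = 0..<2 * k. M $$ (i,h) * pair_diag k l c $$ (h,l + j))"
    using M ij by (simp add: scalar_prod_def)
  also have "\<dots> = (\<Sum>h<k. (if h = j then M $$ (i,k + j) * c j else 0))"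
    unfolding halves using ij
    by (intro sum.cong refl) (auto simp: pair_diag_def realify_index[OF P])
  finally show "(M * pair_diag k l c) $$ (i,l + j) = (if j < k then M $$ (i,k + j) * c j else 0)" by simp
qed

text \<open>
Columns that are symplectically orthogonal, the pair \<open>(i, k + i)\<close> having symplectic product
\<open>e i\<close>. The value \<open>0\<close> is permitted, in order to cover the vanishing columns of a stationary point.
\<close>

definition symplectic_frame :: "nat \<Rightarrow> nat \<Rightarrow> real mat \<Rightarrow> (nat \<Rightarrow> real) \<Rightarrow> bool" where
  "symplectic_frame n k Y e \<longleftrightarrow> Y \<in> carrier_mat (2 * n) (2 * k) \<and>
    Y\<^sup>T * J_mat n * Y = J_mat k * pair_diag k k e"

text \<open>
The equations of symplectic eigenvector pairs, for all pairs at once: the right factor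
swaps the columns \<open>i\<close> and \<open>k + i\<close>, one of them with a sign, and scales them by \<open>d i\<close>.
\<close>

definition eigen_frame :: "nat \<Rightarrow> nat \<Rightarrow> real mat \<Rightarrow> real mat \<Rightarrow> (nat \<Rightarrow> real) \<Rightarrow> bool" where
  "eigen_frame n k A Y d \<longleftrightarrow> A * Y = J_mat n * (Y * ((J_mat k)\<^sup>T * pair_diag k k d))"

lemma Sp_iff_symplectic_frame: "S \<in> Sp q n \<longleftrightarrow> symplectic_frame n q S (\<lambda>_. 1)"
  by (simp add: Sp_def symplectic_frame_def pair_diag_one)

text \<open>
Both columns of a pair are multiplied by the same \<open>c i\<close>, so their symplectic product is multiplied
by its square. Pairs added beyond the \<open>k\<close>-th are zero columns.
\<close>

lemma symplectic_frame_mult_pair_diag: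
  assumes "symplectic_frame n k Y e"
  shows "symplectic_frame n l (Y * pair_diag k l c) (\<lambda>i. if i < k then e i * (c i)\<^sup>2 else 0)"
proof -
  let ?B = "pair_diag k l c" and ?Bt = "pair_diag l k c" and ?E = "pair_diag k k e"
  let ?e = "\<lambda>i. if i < k then e i * (c i)\<^sup>2 else 0"
  have Y: "Y \<in> carrier_mat (2 * n) (2 * k)" and fr: "Y\<^sup>T * J_mat n * Y = J_mat k * ?E"
    using assms by (simp_all add: symplectic_frame_def)
  have Yt: "Y\<^sup>T \<in> carrier_mat (2 * k) (2 * n)" using Y by simp
  note cs = Y Yt J_mat_carrier[of n] J_mat_carrier[of k] J_mat_carrier[of l]
    pair_diag_carrier[of k l c] pair_diag_carrier[of l k c] pair_diag_carrier[of k k e]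
  have YtJ: "Y\<^sup>T * J_mat n \<in> carrier_mat (2 * k) (2 * n)" using cs by (meson mult_carrier_mat)
  have YtJY: "Y\<^sup>T * J_mat n * Y \<in> carrier_mat (2 * k) (2 * k)" using YtJ cs by (meson mult_carrier_mat)
  have "(Y * ?B)\<^sup>T * J_mat n * (Y * ?B) = ?Bt * Y\<^sup>T * J_mat n * (Y * ?B)"
    using cs by (simp add: transpose_mult[of _ "2 * n" "2 * k" _ "2 * l"] transpose_pair_diag)
  also have "?Bt * Y\<^sup>T * J_mat n = ?Bt * (Y\<^sup>T * J_mat n)"
    by (rule assoc_mult_mat) (use cs in auto)
  also have "?Bt * (Y\<^sup>T * J_mat n) * (Y * ?B) = ?Bt * ((Y\<^sup>T * J_mat n) * (Y * ?B))"
    by (rule assoc_mult_mat[OF _ YtJ]) (use cs in auto)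
  also have "(Y\<^sup>T * J_mat n) * (Y * ?B) = Y\<^sup>T * J_mat n * Y * ?B"
    by (rule assoc_mult_mat[symmetric, OF YtJ]) (use cs in auto)
  also have "\<dots> = J_mat k * (?E * ?B)"
    unfolding fr by (rule assoc_mult_mat) (use cs in auto)
  also have "?Bt * (J_mat k * (?E * ?B)) = ?Bt * J_mat k * (?E * ?B)"
    by (rule assoc_mult_mat[symmetric, of _ _ "2 * k" _ "2 * k" _ "2 * l"]) (auto simp: pair_diag_mult)
  also have "?Bt * J_mat k = J_mat l * ?Bt" by (simp add: J_mat_pair_diag_commute)
  also have "J_mat l * ?Bt * (?E * ?B) = J_mat l * (?Bt * (?E * ?B))"
    by (rule assoc_mult_mat[of _ _ "2 * l" _ "2 * k" _ "2 * l"]) (auto simp: pair_diag_mult)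
  also have "?Bt * (?E * ?B) = pair_diag l l ?e"
    by (auto simp: pair_diag_mult power2_eq_square intro!: pair_diag_cong)
  finally show ?thesis using Y by (simp add: symplectic_frame_def mult_carrier_mat[of _ _ "2 * k"])
qed

text \<open>
Both columns of a pair enter the eigenvector equations linearly and are scaled by the same factor,
so the eigenvalue of the pair does not change. For pairs that are added as zero columns, \<open>d'\<close> is
arbitrary.
\<close>

lemma eigen_frame_mult_pair_diag:
  assumes A: "A \<in> carrier_mat (2 * n) (2 * n)" and Y: "Y \<in> carrier_mat (2 * n) (2 * k)"
    and ev: "eigen_frame n k A Y d" and d: "\<And>i. i < k \<Longrightarrow> i < l \<Longrightarrow> d' i = d i"
  shows "eigen_frame n l A (Y * pair_diag k l c) d'"
proof -
  let ?B = "pair_diag k l c" and ?D = "pair_diag k k d" and ?D' = "pair_diag l l d'"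
  have Jt: "(J_mat k)\<^sup>T \<in> carrier_mat (2 * k) (2 * k)" for k by simp
  have JD: "(J_mat k)\<^sup>T * ?D \<in> carrier_mat (2 * k) (2 * k)"
    by (rule mult_carrier_mat[OF Jt pair_diag_carrier])
  have JD': "(J_mat l)\<^sup>T * ?D' \<in> carrier_mat (2 * l) (2 * l)"
    by (rule mult_carrier_mat[OF Jt pair_diag_carrier])
  have YJD: "Y * ((J_mat k)\<^sup>T * ?D) \<in> carrier_mat (2 * n) (2 * k)" by (rule mult_carrier_mat[OF Y JD])
  have DB: "?D * ?B = ?B * ?D'"
    unfolding pair_diag_mult by (rule pair_diag_cong) (use d in auto)
  have "A * (Y * ?B) = A * Y * ?B"
    by (rule assoc_mult_mat[symmetric, OF A Y pair_diag_carrier])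
  also have "\<dots> = J_mat n * (Y * ((J_mat k)\<^sup>T * ?D) * ?B)"
    unfolding ev[unfolded eigen_frame_def]
    by (rule assoc_mult_mat[OF J_mat_carrier YJD pair_diag_carrier])
  also have "Y * ((J_mat k)\<^sup>T * ?D) * ?B = Y * ((J_mat k)\<^sup>T * ?D * ?B)"
    by (rule assoc_mult_mat[OF Y JD pair_diag_carrier])
  also have "(J_mat k)\<^sup>T * ?D * ?B = (J_mat k)\<^sup>T * (?B * ?D')"
    unfolding DB[symmetric] by (rule assoc_mult_mat[OF Jt pair_diag_carrier pair_diag_carrier])
  also have "\<dots> = (J_mat k)\<^sup>T * ?B * ?D'"
    by (rule assoc_mult_mat[symmetric, OF Jt pair_diag_carrier pair_diag_carrier])
  also have "(J_mat k)\<^sup>T * ?B = ?B * (J_mat l)\<^sup>T" by (rule transpose_J_mat_pair_diag_commute)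
  also have "?B * (J_mat l)\<^sup>T * ?D' = ?B * ((J_mat l)\<^sup>T * ?D')"
    by (rule assoc_mult_mat[OF pair_diag_carrier Jt pair_diag_carrier])
  also have "Y * (?B * ((J_mat l)\<^sup>T * ?D')) = Y * ?B * ((J_mat l)\<^sup>T * ?D')"
    by (rule assoc_mult_mat[symmetric, OF Y pair_diag_carrier JD'])
  finally show ?thesis by (simp add: eigen_frame_def)
qed

text \<open>
For a scaled frame the defect \<open>Y\<^sup>T J Y - J\<close> is \<open>J\<close> times a diagonal matrix, which makes the cubic
stationarity equation a linear one.
\<close>

lemma symplectic_frame_stationary_iff:
  assumes A: "A \<in> carrier_mat (2 * n) (2 * n)" and fr: "symplectic_frame n k Y e"
  shows "A * Y = \<beta> \<cdot>\<^sub>m (J_mat n * Y * (Y\<^sup>T * J_mat n * Y - J_mat k)) \<longleftrightarrow>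
    eigen_frame n k A Y (\<lambda>i. \<beta> * (1 - e i))"
proof -
  let ?M = "J_mat k * pair_diag k k e - J_mat k"
  have Y: "Y \<in> carrier_mat (2 * n) (2 * k)" and eq: "Y\<^sup>T * J_mat n * Y = J_mat k * pair_diag k k e"
    using fr by (simp_all add: symplectic_frame_def)
  have M: "?M \<in> carrier_mat (2 * k) (2 * k)" by (intro minus_carrier_mat) simp
  have "\<beta> \<cdot>\<^sub>m ?M = (J_mat k)\<^sup>T * pair_diag k k (\<lambda>i. \<beta> * (1 - e i))"
    unfolding pair_diag_square transpose_J_mat mat_diag_mult_right[OF J_mat_carrier]
      mat_diag_mult_right[OF uminus_carrier_mat[OF J_mat_carrier]]
    by (intro eq_matI) (auto simp: algebra_simps)
  moreover have "\<beta> \<cdot>\<^sub>m (J_mat n * Y * ?M) = J_mat n * (Y * (\<beta> \<cdot>\<^sub>m ?M))"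
    using Y M by (simp add: assoc_mult_mat[of _ "2 * n" "2 * n" _ "2 * k" _ "2 * k"]
        mult_smult_distrib[of _ "2 * n" "2 * k" _ "2 * k"] mult_smult_distrib[of _ "2 * n" "2 * n" _ "2 * k"])
  ultimately show ?thesis by (simp add: eigen_frame_def eq)
qed

lemma eigen_frame_gram:
  assumes A: "A \<in> carrier_mat (2 * n) (2 * n)" and fr: "symplectic_frame n k Y e"
    and ev: "eigen_frame n k A Y d"
  shows "Y\<^sup>T * A * Y = pair_diag k k (\<lambda>i. e i * d i)"
proof -
  let ?E = "pair_diag k k e" and ?D = "pair_diag k k d"
  have Y: "Y \<in> carrier_mat (2 * n) (2 * k)" and eq: "Y\<^sup>T * J_mat n * Y = J_mat k * ?E"
    using fr by (simp_all add: symplectic_frame_def)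
  have Yt: "Y\<^sup>T \<in> carrier_mat (2 * k) (2 * n)" using Y by simp
  have Jt: "(J_mat k)\<^sup>T \<in> carrier_mat (2 * k) (2 * k)" by simp
  have JD: "(J_mat k)\<^sup>T * ?D \<in> carrier_mat (2 * k) (2 * k)"
    by (rule mult_carrier_mat[OF Jt pair_diag_carrier])
  have YJD: "Y * ((J_mat k)\<^sup>T * ?D) \<in> carrier_mat (2 * n) (2 * k)" by (rule mult_carrier_mat[OF Y JD])
  have YtJ: "Y\<^sup>T * J_mat n \<in> carrier_mat (2 * k) (2 * n)" by (rule mult_carrier_mat[OF Yt J_mat_carrier])
  have "Y\<^sup>T * A * Y = Y\<^sup>T * (A * Y)" by (rule assoc_mult_mat[OF Yt A Y])
  also have "\<dots> = Y\<^sup>T * J_mat n * (Y * ((J_mat k)\<^sup>T * ?D))"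
    unfolding ev[unfolded eigen_frame_def] by (rule assoc_mult_mat[symmetric, OF Yt J_mat_carrier YJD])
  also have "\<dots> = Y\<^sup>T * J_mat n * Y * ((J_mat k)\<^sup>T * ?D)"
    by (rule assoc_mult_mat[symmetric, OF YtJ Y JD])
  also have "\<dots> = ?E * (J_mat k * ((J_mat k)\<^sup>T * ?D))"
    unfolding eq J_mat_pair_diag_commute by (rule assoc_mult_mat[OF pair_diag_carrier J_mat_carrier JD])
  also have "J_mat k * ((J_mat k)\<^sup>T * ?D) = J_mat k * (J_mat k)\<^sup>T * ?D"
    by (rule assoc_mult_mat[symmetric, OF J_mat_carrier Jt pair_diag_carrier])
  also have "J_mat k * (J_mat k)\<^sup>T = 1\<^sub>m (2 * k)" by (simp add: transpose_J_mat J_mat_square)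
  also have "1\<^sub>m (2 * k) * ?D = ?D" by (rule left_mult_one_mat[OF pair_diag_carrier])
  also have "?E * ?D = pair_diag k k (\<lambda>i. e i * d i)"
    unfolding pair_diag_mult by (rule pair_diag_cong) auto
  finally show ?thesis .
qed

lemma gram_index:
  assumes "Y \<in> carrier_mat N m" "B \<in> carrier_mat N N" "i < m" "j < m"
  shows "(Y\<^sup>T * B * Y) $$ (i,j) = col Y i \<bullet> (B *\<^sub>v col Y j)"
  using assms by (subst assoc_mult_mat[of _ m N _ N _ m]) (auto simp: mult_mat_vec_def)

text \<open>
The diagonal entries of \<open>Y\<^sup>T A Y\<close> are \<open>e i * d i\<close> by \<open>eigen_frame_gram\<close>, and positive exactly
for nonzero columns. A pair with \<open>e i \<noteq> 0\<close> cannot contain a zero column, because \<open>e i\<close> is the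
symplectic product of its columns.
\<close>

lemma eigen_frame_pos_def:
  assumes A: "A \<in> carrier_mat (2 * n) (2 * n)" and pd: "pos_def_mat A"
    and fr: "symplectic_frame n k Y e" and ev: "eigen_frame n k A Y d" and i: "i < k"
  shows "e i = 0 \<Longrightarrow> col Y i = 0\<^sub>v (2 * n) \<and> col Y (k + i) = 0\<^sub>v (2 * n)"
    and "e i \<noteq> 0 \<Longrightarrow> 0 < e i * d i"
proof -
  have Y: "Y \<in> carrier_mat (2 * n) (2 * k)" and eq: "Y\<^sup>T * J_mat n * Y = J_mat k * pair_diag k k e"
    using fr by (simp_all add: symplectic_frame_def)
  have c: "col Y j \<in> carrier_vec (2 * n)" if "j < 2 * k" for j using Y that by auto
  have gram: "col Y j \<bullet> (A *\<^sub>v col Y j) = e (j mod k) * d (j mod k)" if "j < 2 * k" for j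
    using gram_index[OF Y A that that] eigen_frame_gram[OF A fr ev] that
    by (simp add: pair_diag_square mat_diag_def)
  have pos: "0 < e (j mod k) * d (j mod k)" if "j < 2 * k" "col Y j \<noteq> 0\<^sub>v (2 * n)" for j
    using pd A c[OF that(1)] that(2) gram[OF that(1)] unfolding pos_def_mat_def by auto
  show "col Y i = 0\<^sub>v (2 * n) \<and> col Y (k + i) = 0\<^sub>v (2 * n)" if "e i = 0"
    using pos[of i] pos[of "k + i"] that i by auto
  show "0 < e i * d i" if "e i \<noteq> 0"
  proof -
    have "col Y i \<bullet> (J_mat n *\<^sub>v col Y (k + i)) = (J_mat k * pair_diag k k e) $$ (i, k + i)"
      using gram_index[OF Y J_mat_carrier, of i "k + i"] i by (simp add: eq)
    also have "\<dots> = e i"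
      using mult_pair_diag_index(2)[OF J_mat_carrier, of i k i k e] i by (simp add: J_mat_index)
    finally have "col Y i \<bullet> (J_mat n *\<^sub>v col Y (k + i)) = e i" .
    moreover have "J_mat n *\<^sub>v col Y (k + i) \<in> carrier_vec (2 * n)"
      by (rule mult_mat_vec_carrier[OF J_mat_carrier c]) (use i in simp)
    ultimately have "col Y i \<noteq> 0\<^sub>v (2 * n)" using that by auto
    then show ?thesis using pos[of i] i by simp
  qed
qed


section \<open>Square roots of positive definite matrices\<close>

text \<open>
Uniqueness of the root: if \<open>R\<^sup>2 = Q\<^sup>2\<close>, then \<open>W = R - Q\<close> and \<open>P = R + Q\<close> anticommute. For symmetric
matrices this makes \<open>\<langle>W, P W\<rangle>\<close> equal to its negative, hence zero. But it is the sum of the values of the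
quadratic form of \<open>P\<close> at the columns of \<open>W\<close>, and \<open>P\<close> is positive definite; so \<open>W = 0\<close>.
\<close>

lemma mat_sqrt_eqI:
  assumes Q: "Q \<in> carrier_mat m m" and pd: "pos_def_mat Q" and QQ: "Q * Q = M"
  shows "mat_sqrt M = Q"
  unfolding mat_sqrt_def
proof (rule the_equality)
  have M: "M \<in> carrier_mat m m" using Q QQ by auto
  have QT: "Q\<^sup>T = Q" using pd by (simp add: pos_def_mat_def)
  have "0 \<le> v \<bullet> (Q *\<^sub>v v)" if "v \<in> carrier_vec m" for v
  proof (cases "v = 0\<^sub>v m")
    case True
    then show ?thesis using mult_mat_vec_carrier[OF Q that] by simp
  next
    case False
    then show ?thesis using pd Q that unfolding pos_def_mat_def by (auto intro: less_imp_le)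
  qed
  then show "Q \<in> carrier_mat (dim_row M) (dim_row M) \<and> pos_semidef_mat Q \<and> Q * Q = M"
    using pd Q M QQ by (auto simp: pos_semidef_mat_def pos_def_mat_def)
next
  fix R assume "R \<in> carrier_mat (dim_row M) (dim_row M) \<and> pos_semidef_mat R \<and> R * R = M"
  moreover have "dim_row M = m" using Q QQ by auto
  ultimately have R: "R \<in> carrier_mat m m" and psd: "pos_semidef_mat R" and RR: "R * R = M" by auto
  have RT: "R\<^sup>T = R" using psd by (simp add: pos_semidef_mat_def)
  have QT: "Q\<^sup>T = Q" using pd by (simp add: pos_def_mat_def)
  define W where "W = R - Q"
  define P where "P = R + Q"
  have W: "W \<in> carrier_mat m m" using Q by (simp add: W_def minus_carrier_mat)
  have P: "P \<in> carrier_mat m m" using Q by (simp add: P_def)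
  have WT: "W\<^sup>T = W" unfolding W_def using transpose_minus[OF R Q] by (simp add: RT QT)
  have PT: "P\<^sup>T = P" unfolding P_def using transpose_add[OF R Q] by (simp add: RT QT)
  have PW: "P * W \<in> carrier_mat m m" and WP: "W * P \<in> carrier_mat m m" using W P by auto
  have RQ: "R * Q \<in> carrier_mat m m" and QR: "Q * R \<in> carrier_mat m m" and M: "M \<in> carrier_mat m m"
    using R Q QQ by auto
  have "P * W = R * W + Q * W" unfolding P_def by (rule add_mult_distrib_mat[OF R Q W])
  moreover have "R * W = R * R - R * Q" unfolding W_def by (rule mult_minus_distrib_mat[OF R R Q])
  moreover have "Q * W = Q * R - Q * Q" unfolding W_def by (rule mult_minus_distrib_mat[OF Q R Q])
  moreover have "W * P = R * P - Q * P" unfolding W_def by (rule minus_mult_distrib_mat[OF R Q P])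
  moreover have "R * P = R * R + R * Q" unfolding P_def by (rule mult_add_distrib_mat[OF R R Q])
  moreover have "Q * P = Q * R + Q * Q" unfolding P_def by (rule mult_add_distrib_mat[OF Q R Q])
  ultimately have anti: "P * W = - (W * P)"
    using R Q RQ QR M unfolding RR QQ by (auto intro!: eq_matI)
  have "frob_inner W (P * W) = - frob_inner W (W * P)"
    unfolding anti using W P WP by (simp add: frob_inner_eq_sum[of W m m] sum_negf)
  also have "frob_inner W (W * P) = frob_inner W\<^sup>T (W * P)\<^sup>T"
    by (rule frob_inner_transpose[OF W WP, symmetric])
  also have "\<dots> = frob_inner W (P * W)" by (simp add: transpose_mult[OF W P] WT PT)
  finally have zero: "frob_inner W (P * W) = 0" by simp
  have Ppos: "0 < x \<bullet> (P *\<^sub>v x)" if "x \<in> carrier_vec m" "x \<noteq> 0\<^sub>v m" for x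
  proof -
    have "x \<bullet> (P *\<^sub>v x) = x \<bullet> (R *\<^sub>v x) + x \<bullet> (Q *\<^sub>v x)"
      unfolding P_def add_mult_distrib_mat_vec[OF R Q that(1)]
      by (rule scalar_prod_add_distrib[OF that(1) mult_mat_vec_carrier[OF R that(1)]
            mult_mat_vec_carrier[OF Q that(1)]])
    moreover have "0 \<le> x \<bullet> (R *\<^sub>v x)" using psd R that unfolding pos_semidef_mat_def by auto
    moreover have "0 < x \<bullet> (Q *\<^sub>v x)" using pd Q that unfolding pos_def_mat_def by auto
    ultimately show ?thesis by simp
  qed
  have cW: "col W j \<in> carrier_vec m" for j using W by auto
  have "frob_inner W (P * W) = (\<Sum>j<m. col W j \<bullet> (P *\<^sub>v col W j))"
  proof -
    have "frob_inner W (P * W) = trace_mat (W\<^sup>T * P * W)"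
      unfolding frob_inner_def using W P by (subst assoc_mult_mat[of _ m m _ m _ m]) auto
    also have "\<dots> = (\<Sum>j<m. (W\<^sup>T * P * W) $$ (j,j))"
      using W by (simp add: trace_mat_def del: assoc_mult_mat)
    also have "\<dots> = (\<Sum>j<m. col W j \<bullet> (P *\<^sub>v col W j))"
      by (rule sum.cong) (auto intro!: gram_index[OF W P])
    finally show ?thesis .
  qed
  moreover have nonneg: "0 \<le> col W j \<bullet> (P *\<^sub>v col W j)" for j
    using Ppos[OF cW[of j]] mult_mat_vec_carrier[OF P cW[of j]]
    by (cases "col W j = 0\<^sub>v m") auto
  ultimately have "\<forall>j<m. col W j \<bullet> (P *\<^sub>v col W j) = 0"
    using zero by (auto simp: sum_nonneg_eq_0_iff)
  then have "col W j = 0\<^sub>v m" if "j < m" for j using Ppos[OF cW[of j]] that by force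
  then have W0: "W $$ (i,j) = 0" if "i < m" "j < m" for i j
    using that W by (metis carrier_matD index_col index_zero_vec(1))
  show "R = Q"
  proof (rule eq_matI)
    fix i j assume "i < dim_row Q" "j < dim_col Q"
    then show "R $$ (i,j) = Q $$ (i,j)" using W0[of i j] R Q by (simp add: W_def)
  qed (use R Q in auto)
qed

lemma pos_def_mat_diag_iff:
  "pos_def_mat (mat_diag m a) \<longleftrightarrow> (\<forall>i<m. 0 < a i)"
proof
  assume pd: "pos_def_mat (mat_diag m a)"
  show "\<forall>i<m. 0 < a i"
  proof (intro allI impI)
    fix i assume i: "i < m"
    \<comment> \<open>The diagonal entries are the values of the quadratic form at the unit vectors.\<close>
    have "unit_vec m i \<noteq> (0\<^sub>v m :: real vec)"
      using i by (metis index_unit_vec(1) index_zero_vec(1) one_neq_zero)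
    then have "0 < unit_vec m i \<bullet> (mat_diag m a *\<^sub>v unit_vec m i)"
      using pd i unfolding pos_def_mat_def by (auto simp: mat_diag_def)
    also have "\<dots> = (mat_diag m a *\<^sub>v unit_vec m i) $ i"
      by (rule scalar_prod_left_unit[OF mult_mat_vec_carrier[OF mat_diag_dim unit_vec_carrier] i])
    also have "\<dots> = a i" using i by (simp add: mat_diag_def)
    finally show "0 < a i" .
  qed
next
  assume a: "\<forall>i<m. 0 < a i"
  have T: "(mat_diag m a)\<^sup>T = mat_diag m a" by (intro eq_matI) (auto simp: mat_diag_def)
  have "0 < v \<bullet> (mat_diag m a *\<^sub>v v)" if v: "v \<in> carrier_vec m" "v \<noteq> 0\<^sub>v m" for v
  proof -
    obtain i where i: "i < m" "v $ i \<noteq> 0" using v by (metis carrier_vecD eq_vecI index_zero_vec)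
    have "mat_diag m a *\<^sub>v v = vec m (\<lambda>i. a i * v $ i)"
    proof (rule eq_vecI)
      fix i assume "i < dim_vec (vec m (\<lambda>i. a i * v $ i))"
      then have i: "i < m" by simp
      have "(mat_diag m a *\<^sub>v v) $ i = (\<Sum>j = 0..<m. mat_diag m a $$ (i,j) * v $ j)"
        using i v by (simp add: scalar_prod_def carrier_matD[OF mat_diag_dim])
      also have "\<dots> = (\<Sum>j = 0..<m. if j = i then a i * v $ i else 0)"
        using i by (intro sum.cong refl) (auto simp: mat_diag_def)
      finally show "(mat_diag m a *\<^sub>v v) $ i = vec m (\<lambda>i. a i * v $ i) $ i" using i by simp
    qed (simp add: mat_diag_def)
    then have "v \<bullet> (mat_diag m a *\<^sub>v v) = (\<Sum>j = 0..<m. a j * (v $ j)\<^sup>2)"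
      by (simp add: scalar_prod_def power2_eq_square mult_ac)
    also have "\<dots> > 0"
      using a i by (intro sum_pos2[of _ i]) (auto simp: less_imp_le)
    finally show ?thesis .
  qed
  then show "pos_def_mat (mat_diag m a)" using T by (auto simp: pos_def_mat_def mat_diag_def)
qed

lemma mat_sqrt_mat_diag:
  assumes "\<And>i. i < m \<Longrightarrow> 0 < a i"
  shows "mat_sqrt (mat_diag m a) = mat_diag m (\<lambda>i. sqrt (a i))"
proof (rule mat_sqrt_eqI[OF mat_diag_dim])
  show "pos_def_mat (mat_diag m (\<lambda>i. sqrt (a i)))" using assms by (simp add: pos_def_mat_diag_iff)
  show "mat_diag m (\<lambda>i. sqrt (a i)) * mat_diag m (\<lambda>i. sqrt (a i)) = mat_diag m a"
    unfolding mat_diag_diag using assms by (intro eq_matI) (auto simp: mat_diag_def less_imp_le)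
qed

lemma diagonal_mat_eq_mat_diag:
  assumes "D \<in> carrier_mat m m" "diagonal_mat D"
  shows "D = mat_diag m (\<lambda>i. D $$ (i,i))"
  using assms by (intro eq_matI) (auto simp: mat_diag_def diagonal_mat_def)


section \<open>Symplectic eigenvector pairs and the block form of the decomposition\<close>

text \<open>
A matrix equation holds iff it holds column by column. This links \<open>eigen_frame\<close> to eigenvector
equations stated pair by pair, and shows that it depends only on the first \<open>k\<close> values of \<open>d\<close>.
\<close>

lemma eigen_frame_iff_cols:
  assumes A: "A \<in> carrier_mat (2 * n) (2 * n)" and Y: "Y \<in> carrier_mat (2 * n) (2 * k)"
  shows "eigen_frame n k A Y d \<longleftrightarrow> (\<forall>i<k.
    A *\<^sub>v col Y i = J_mat n *\<^sub>v (d i \<cdot>\<^sub>v col Y (k + i)) \<and>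
    A *\<^sub>v col Y (k + i) = J_mat n *\<^sub>v (- d i \<cdot>\<^sub>v col Y i))"
proof -
  let ?Z = "Y * ((J_mat k)\<^sup>T * pair_diag k k d)"
  have Jt: "(J_mat k)\<^sup>T \<in> carrier_mat (2 * k) (2 * k)" by simp
  have YJ: "Y * (J_mat k)\<^sup>T \<in> carrier_mat (2 * n) (2 * k)" by (rule mult_carrier_mat[OF Y Jt])
  have Zeq: "?Z = Y * (J_mat k)\<^sup>T * pair_diag k k d"
    by (rule assoc_mult_mat[symmetric, OF Y Jt pair_diag_carrier])
  have Z: "?Z \<in> carrier_mat (2 * n) (2 * k)"
    unfolding Zeq by (rule mult_carrier_mat[OF YJ pair_diag_carrier])
  have YJneg: "Y * (J_mat k)\<^sup>T = - (Y * J_mat k)" using Y by (simp add: transpose_J_mat)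
  have Zi: "?Z $$ (r,i) = d i * Y $$ (r,k + i)" "?Z $$ (r,k + i) = - d i * Y $$ (r,i)"
    if "r < 2 * n" "i < k" for r i
    unfolding Zeq using that Y mult_pair_diag_index[OF YJ that] mult_J_mat_index[OF Y that]
    by (simp_all add: YJneg del: index_mult_mat(1))
  have colZ: "col ?Z i = d i \<cdot>\<^sub>v col Y (k + i)" "col ?Z (k + i) = - d i \<cdot>\<^sub>v col Y i" if i: "i < k" for i
    using carrier_matD[OF Y] carrier_matD[OF Z] i
    by (intro eq_vecI; simp add: index_col Zi del: index_mult_mat(1) index_mult_mat(2) index_mult_mat(3))+
  have "eigen_frame n k A Y d \<longleftrightarrow> (\<forall>j<2 * k. A *\<^sub>v col Y j = J_mat n *\<^sub>v col ?Z j)"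
  proof
    assume "eigen_frame n k A Y d"
    then show "\<forall>j<2 * k. A *\<^sub>v col Y j = J_mat n *\<^sub>v col ?Z j"
      unfolding eigen_frame_def using col_mult2[OF A Y] col_mult2[OF J_mat_carrier Z] by metis
  next
    assume "\<forall>j<2 * k. A *\<^sub>v col Y j = J_mat n *\<^sub>v col ?Z j"
    then have c: "col (A * Y) j = col (J_mat n * ?Z) j" if "j < 2 * k" for j
      using col_mult2[OF A Y that] col_mult2[OF J_mat_carrier Z that] that by simp
    have "dim_col (J_mat n * ?Z) = 2 * k" "dim_row (J_mat n * ?Z) = 2 * n" using Z by simp_all
    then show "eigen_frame n k A Y d"
      unfolding eigen_frame_def using A Y c by (intro mat_col_eqI) (simp_all del: col_mult)
  qed
  also have "\<dots> \<longleftrightarrow> (\<forall>i<k. A *\<^sub>v col Y i = J_mat n *\<^sub>v col ?Z i \<and>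
      A *\<^sub>v col Y (k + i) = J_mat n *\<^sub>v col ?Z (k + i))" (is "?L = ?R")
  proof
    assume R: ?R
    show ?L
    proof (intro allI impI)
      fix j assume j: "j < 2 * k"
      show "A *\<^sub>v col Y j = J_mat n *\<^sub>v col ?Z j"
      proof (cases "j < k")
        case False
        then show ?thesis using R[rule_format, of "j - k"] j by simp
      qed (use R in auto)
    qed
  qed auto
  finally show ?thesis using colZ by simp
qed

text \<open>
The defining equation of a single pair is the case \<open>k = 1\<close> of \<open>eigen_frame\<close>.
\<close>

lemma symplectic_eigenvector_pairs_iff:
  assumes A: "A \<in> carrier_mat (2 * n) (2 * n)"
  shows "symplectic_eigenvector_pairs n q A S D \<longleftrightarrow>
    S \<in> Sp q n \<and> eigen_frame n q A S (\<lambda>i. D $$ (i,i))"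
proof (cases "S \<in> Sp q n")
  case True
  then have S: "S \<in> carrier_mat (2 * n) (2 * q)" by (simp add: Sp_def)
  have "A * P = D $$ (i,i) \<cdot>\<^sub>m (J_mat n * P * (J_mat 1)\<^sup>T) \<longleftrightarrow>
      A *\<^sub>v col S i = J_mat n *\<^sub>v (D $$ (i,i) \<cdot>\<^sub>v col S (q + i)) \<and>
      A *\<^sub>v col S (q + i) = J_mat n *\<^sub>v (- D $$ (i,i) \<cdot>\<^sub>v col S i)"
    if i: "i < q" and P_def: "P = mat_of_cols (2 * n) [col S i, col S (i + q)]" for i P
  proof -
    have P: "P \<in> carrier_mat (2 * n) (2 * 1)" by (simp add: P_def carrier_matI)
    have c: "col P 0 = col S i" "col P 1 = col S (q + i)"
      using S i by (auto simp: P_def mat_of_cols_index add.commute intro!: eq_vecI)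
    have Jt: "(J_mat 1)\<^sup>T \<in> carrier_mat (2 * 1) (2 * 1)"
      by (simp only: transpose_carrier_mat J_mat_carrier)
    have PJ: "P * (J_mat 1)\<^sup>T \<in> carrier_mat (2 * n) (2 * 1)" by (rule mult_carrier_mat[OF P Jt])
    have pd: "pair_diag 1 1 (\<lambda>_. t) = t \<cdot>\<^sub>m 1\<^sub>m (2 * 1)" for t
      unfolding pair_diag_square by (intro eq_matI) (auto simp: mat_diag_def)
    have "(J_mat 1)\<^sup>T * pair_diag 1 1 (\<lambda>_. t) = t \<cdot>\<^sub>m (J_mat 1)\<^sup>T" for t
      unfolding pd mult_smult_distrib[OF Jt one_carrier_mat] right_mult_one_mat[OF Jt] ..
    then have "J_mat n * (P * ((J_mat 1)\<^sup>T * pair_diag 1 1 (\<lambda>_. t))) = t \<cdot>\<^sub>m (J_mat n * P * (J_mat 1)\<^sup>T)" for t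
      by (simp only: mult_smult_distrib[OF P Jt] mult_smult_distrib[OF J_mat_carrier PJ]
          assoc_mult_mat[OF J_mat_carrier P Jt])
    then have "A * P = D $$ (i,i) \<cdot>\<^sub>m (J_mat n * P * (J_mat 1)\<^sup>T) \<longleftrightarrow> eigen_frame n 1 A P (\<lambda>_. D $$ (i,i))"
      by (simp only: eigen_frame_def)
    then show ?thesis unfolding eigen_frame_iff_cols[OF A P] using c by simp
  qed
  then show ?thesis
    unfolding symplectic_eigenvector_pairs_def eigen_frame_iff_cols[OF A S] Let_def using True by auto
qed (simp add: symplectic_eigenvector_pairs_def)

lemma append_cols_index:
  assumes "A \<in> carrier_mat r a" "B \<in> carrier_mat r b" "i < r" "j < a + b"
  shows "(A @\<^sub>c B) $$ (i,j) = (if j < a then A $$ (i,j) else B $$ (i,j - a))"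
  using assms by (simp add: append_cols_def)

lemma append_cols_carrier:
  assumes "A \<in> carrier_mat r a" "B \<in> carrier_mat r b"
  shows "A @\<^sub>c B \<in> carrier_mat r (a + b)"
  using assms by (auto simp: append_cols_def intro!: carrier_matI)

lemma append_cols_split:
  assumes "S \<in> carrier_mat r (2 * q)"
  obtains S1 S2 where "S1 \<in> carrier_mat r q" "S2 \<in> carrier_mat r q" "S = S1 @\<^sub>c S2"
proof -
  define S1 where "S1 = mat r q (\<lambda>(i,j). S $$ (i,j))"
  define S2 where "S2 = mat r q (\<lambda>(i,j). S $$ (i,q + j))"
  have c: "S1 \<in> carrier_mat r q" "S2 \<in> carrier_mat r q" by (simp_all add: S1_def S2_def)
  have "S = S1 @\<^sub>c S2"
  proof (rule eq_matI)
    fix i j assume "i < dim_row (S1 @\<^sub>c S2)" "j < dim_col (S1 @\<^sub>c S2)"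
    then have ij: "i < r" "j < q + q" using append_cols_carrier[OF c] by auto
    then show "S $$ (i,j) = (S1 @\<^sub>c S2) $$ (i,j)"
      unfolding append_cols_index[OF c ij] by (auto simp: S1_def S2_def)
  qed (use append_cols_carrier[OF c] assms in auto)
  then show ?thesis using that c by blast
qed

lemma diag_block_mat_eq_pair_diag: "diag_block_mat [mat_diag q d, mat_diag q d] = pair_diag q q d"
  unfolding pair_diag_square
  by (rule mat_eq_by_halvesI[of _ q q]) (auto simp: Let_def mat_diag_def)

text \<open>
The bridge between the block form of the decomposition and the scaling of column pairs.
\<close>

lemma append_cols_mult_pair_diag:
  assumes S1: "S1 \<in> carrier_mat r q" and S2: "S2 \<in> carrier_mat r q" and q: "q \<le> p"
  shows "(S1 @\<^sub>c S2) * pair_diag q p c =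
    S1 * mat_diag q c @\<^sub>c 0\<^sub>m r (p - q) @\<^sub>c S2 * mat_diag q c @\<^sub>c 0\<^sub>m r (p - q)"
proof -
  let ?Z = "0\<^sub>m r (p - q) :: real mat"
  define R1 where "R1 = S1 * mat_diag q c"
  define R2 where "R2 = S2 * mat_diag q c"
  have R1: "R1 \<in> carrier_mat r q" and R2: "R2 \<in> carrier_mat r q"
    unfolding R1_def R2_def using S1 S2 mat_diag_dim by (meson mult_carrier_mat)+
  have S: "S1 @\<^sub>c S2 \<in> carrier_mat r (2 * q)" using append_cols_carrier[OF S1 S2] by (simp add: mult_2)
  have Z: "?Z \<in> carrier_mat r (p - q)" by simp
  note c1 = append_cols_carrier[OF R2 Z] 
  note c2 = append_cols_carrier[OF Z c1]
  note c3 = append_cols_carrier[OF R1 c2]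
  have l: "(S1 @\<^sub>c S2) * pair_diag q p c \<in> carrier_mat r (2 * p)"
    by (rule mult_carrier_mat[OF S pair_diag_carrier])
  have "(S1 @\<^sub>c S2) * pair_diag q p c = R1 @\<^sub>c ?Z @\<^sub>c R2 @\<^sub>c ?Z"
  proof (rule eq_matI)
    fix i j assume "i < dim_row (R1 @\<^sub>c ?Z @\<^sub>c R2 @\<^sub>c ?Z)" "j < dim_col (R1 @\<^sub>c ?Z @\<^sub>c R2 @\<^sub>c ?Z)"
    then have i: "i < r" and j: "j < 2 * p" using c3 q by auto
    have R: "R1 $$ (i,h) = S1 $$ (i,h) * c h" "R2 $$ (i,h) = S2 $$ (i,h) * c h" if "h < q" for h
      using that i unfolding R1_def R2_def mat_diag_mult_right[OF S1] mat_diag_mult_right[OF S2] by auto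
    have rhs: "(R1 @\<^sub>c ?Z @\<^sub>c R2 @\<^sub>c ?Z) $$ (i,j) = (if j < q then R1 $$ (i,j) else if j < p then 0
        else if j < p + q then R2 $$ (i,j - p) else 0)"
      using i j q by (simp add: append_cols_index[OF R1 c2] append_cols_index[OF Z c1] append_cols_index[OF R2 Z]) arith
    show "((S1 @\<^sub>c S2) * pair_diag q p c) $$ (i,j) = (R1 @\<^sub>c ?Z @\<^sub>c R2 @\<^sub>c ?Z) $$ (i,j)"
    proof (cases "j < p")
      case True
      then show ?thesis
        unfolding rhs using mult_pair_diag_index(1)[OF S i True, of c] i q
        by (simp add: append_cols_index[OF S1 S2] R del: index_mult_mat(1))
    next
      case False
      define h where "h = j - p"
      have h: "j = p + h" "h < p" using False j by (auto simp: h_def)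
      show ?thesis
        unfolding rhs using mult_pair_diag_index(2)[OF S i h(2), of c] i q h
        by (simp add: append_cols_index[OF S1 S2] R del: index_mult_mat(1))
    qed
  qed (use l c3 q in auto)
  then show ?thesis by (simp add: R1_def R2_def)
qed

section \<open>Stationary points and their frames\<close>

lemma transpose_smult_mat: "(t \<cdot>\<^sub>m M)\<^sup>T = t \<cdot>\<^sub>m M\<^sup>T"
  by (intro eq_matI) auto

text \<open>
Multiplying the stationarity equation by \<open>X\<^sup>T\<close> from the left shows that \<open>M (M - J)\<close> is symmetric, where
\<open>M = X\<^sup>T J X\<close>. As \<open>M\<close> and \<open>J\<close> are skew, its transpose is \<open>(M - J) M\<close>; comparing the two gives the claim.
\<close>

lemma stationary_gram_commutes_J_mat:
  assumes A: "A \<in> carrier_mat (2 * n) (2 * n)" and sym: "A\<^sup>T = A" and \<beta>: "0 < \<beta>"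
    and X: "X \<in> carrier_mat (2 * n) (2 * p)"
    and crit: "A * X = \<beta> \<cdot>\<^sub>m (J_mat n * X * (X\<^sup>T * J_mat n * X - J_mat p))"
  shows "J_mat p * (X\<^sup>T * J_mat n * X) = (X\<^sup>T * J_mat n * X) * J_mat p"
proof -
  define M where "M = X\<^sup>T * J_mat n * X"
  have Xt: "X\<^sup>T \<in> carrier_mat (2 * p) (2 * n)" using X by simp
  have XtJ: "X\<^sup>T * J_mat n \<in> carrier_mat (2 * p) (2 * n)" by (rule mult_carrier_mat[OF Xt J_mat_carrier])
  have JX: "J_mat n * X \<in> carrier_mat (2 * n) (2 * p)" by (rule mult_carrier_mat[OF J_mat_carrier X])
  have M: "M \<in> carrier_mat (2 * p) (2 * p)" unfolding M_def by (rule mult_carrier_mat[OF XtJ X])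
  have Q: "M - J_mat p \<in> carrier_mat (2 * p) (2 * p)" by (rule minus_carrier_mat) simp
  have MT: "M\<^sup>T = - M" unfolding M_def by (rule symplectic_gram_skew[OF X])
  have MM: "M * M \<in> carrier_mat (2 * p) (2 * p)" "M * J_mat p \<in> carrier_mat (2 * p) (2 * p)"
    "J_mat p * M \<in> carrier_mat (2 * p) (2 * p)" using M by auto
  define B where "B = X\<^sup>T * (A * X)"
  have AX: "A * X \<in> carrier_mat (2 * n) (2 * p)" using A X by auto
  have B: "B = \<beta> \<cdot>\<^sub>m (M * (M - J_mat p))"
  proof -
    have "B = \<beta> \<cdot>\<^sub>m (X\<^sup>T * (J_mat n * X * (M - J_mat p)))"
      unfolding B_def crit M_def[symmetric] by (rule mult_smult_distrib[OF Xt mult_carrier_mat[OF JX Q]])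
    also have "X\<^sup>T * (J_mat n * X * (M - J_mat p)) = X\<^sup>T * (J_mat n * X) * (M - J_mat p)"
      by (rule assoc_mult_mat[symmetric, OF Xt JX Q])
    also have "X\<^sup>T * (J_mat n * X) = M" unfolding M_def by (rule assoc_mult_mat[symmetric, OF Xt J_mat_carrier X])
    finally show ?thesis .
  qed
  have "B\<^sup>T = X\<^sup>T * A * X"
    unfolding B_def transpose_mult[OF Xt AX] transpose_mult[OF A X] by (simp add: sym)
  also have "\<dots> = B" unfolding B_def by (rule assoc_mult_mat[OF Xt A X])
  finally have "(\<beta> \<cdot>\<^sub>m (M * (M - J_mat p)))\<^sup>T = \<beta> \<cdot>\<^sub>m (M * (M - J_mat p))" by (simp add: B)
  then have "\<beta> \<cdot>\<^sub>m (M * (M - J_mat p))\<^sup>T = \<beta> \<cdot>\<^sub>m (M * (M - J_mat p))"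
    by (simp only: transpose_smult_mat)
  then have "\<beta> \<cdot>\<^sub>m (M * M - J_mat p * M) = \<beta> \<cdot>\<^sub>m (M * M - M * J_mat p)"
  proof -
    have "(M * (M - J_mat p))\<^sup>T = (M - J_mat p)\<^sup>T * M\<^sup>T" by (rule transpose_mult[OF M Q])
    also have "(M - J_mat p)\<^sup>T = - (M - J_mat p)"
      using M transpose_minus[OF M J_mat_carrier] by (auto simp: MT transpose_J_mat intro!: eq_matI)
    also have "- (M - J_mat p) * M\<^sup>T = (M - J_mat p) * M" using M Q unfolding MT by simp
    also have "\<dots> = M * M - J_mat p * M" by (rule minus_mult_distrib_mat[OF M J_mat_carrier M])
    finally have "(M * (M - J_mat p))\<^sup>T = M * M - J_mat p * M" .
    moreover have "M * (M - J_mat p) = M * M - M * J_mat p" by (rule mult_minus_distrib_mat[OF M M J_mat_carrier])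
    ultimately show ?thesis
      using \<open>\<beta> \<cdot>\<^sub>m (M * (M - J_mat p))\<^sup>T = \<beta> \<cdot>\<^sub>m (M * (M - J_mat p))\<close> by simp
  qed
  note eq = this
  show ?thesis unfolding M_def[symmetric]
  proof (rule eq_matI)
    fix i j assume "i < dim_row (M * J_mat p)" "j < dim_col (M * J_mat p)"
    then have ij: "i < 2 * p" "j < 2 * p" using M by auto
    have "\<beta> * ((M * M) $$ (i,j) - (J_mat p * M) $$ (i,j)) = \<beta> * ((M * M) $$ (i,j) - (M * J_mat p) $$ (i,j))"
      using arg_cong[OF eq, of "\<lambda>N. N $$ (i,j)"] ij M by (simp del: index_mult_mat(1))
    then show "(J_mat p * M) $$ (i,j) = (M * J_mat p) $$ (i,j)" using \<beta> by simp
  qed (use M in auto)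
qed

text \<open>
Both the quadratic form and the penalty are invariant under \<open>X \<mapsto> X T\<close>; on the level of the
equations, \<open>T T\<^sup>T\<close> cancels.
\<close>

lemma stationary_mult_OrSp:
  assumes A: "A \<in> carrier_mat (2 * n) (2 * n)" and X: "X \<in> carrier_mat (2 * n) (2 * p)"
    and T: "T \<in> OrSp p"
    and crit: "A * X = \<beta> \<cdot>\<^sub>m (J_mat n * X * (X\<^sup>T * J_mat n * X - J_mat p))"
  shows "A * (X * T) = \<beta> \<cdot>\<^sub>m (J_mat n * (X * T) * ((X * T)\<^sup>T * J_mat n * (X * T) - J_mat p))"
    and "(X * T)\<^sup>T * J_mat n * (X * T) = T\<^sup>T * (X\<^sup>T * J_mat n * X) * T"
proof -
  define M where "M = X\<^sup>T * J_mat n * X"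
  have Tc: "T \<in> carrier_mat (2 * p) (2 * p)" and sT: "T\<^sup>T * J_mat p * T = J_mat p"
    using T by (auto simp: OrSp_def)
  have Tt: "T\<^sup>T \<in> carrier_mat (2 * p) (2 * p)" using Tc by simp
  have Xt: "X\<^sup>T \<in> carrier_mat (2 * p) (2 * n)" using X by simp
  have XT: "X * T \<in> carrier_mat (2 * n) (2 * p)" by (rule mult_carrier_mat[OF X Tc])
  have XtJ: "X\<^sup>T * J_mat n \<in> carrier_mat (2 * p) (2 * n)" by (rule mult_carrier_mat[OF Xt J_mat_carrier])
  have JX: "J_mat n * X \<in> carrier_mat (2 * n) (2 * p)" by (rule mult_carrier_mat[OF J_mat_carrier X])
  have M: "M \<in> carrier_mat (2 * p) (2 * p)" unfolding M_def by (rule mult_carrier_mat[OF XtJ X])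
  have Q: "M - J_mat p \<in> carrier_mat (2 * p) (2 * p)" by (rule minus_carrier_mat) simp
  have QT: "(M - J_mat p) * T \<in> carrier_mat (2 * p) (2 * p)" by (rule mult_carrier_mat[OF Q Tc])
  have TtM: "T\<^sup>T * M \<in> carrier_mat (2 * p) (2 * p)" "T\<^sup>T * J_mat p \<in> carrier_mat (2 * p) (2 * p)"
    using Tt M by auto
  have "(X * T)\<^sup>T * J_mat n * (X * T) = T\<^sup>T * X\<^sup>T * J_mat n * (X * T)"
    by (simp only: transpose_mult[OF X Tc])
  also have "T\<^sup>T * X\<^sup>T * J_mat n = T\<^sup>T * (X\<^sup>T * J_mat n)" by (rule assoc_mult_mat[OF Tt Xt J_mat_carrier])
  also have "T\<^sup>T * (X\<^sup>T * J_mat n) * (X * T) = T\<^sup>T * (X\<^sup>T * J_mat n * (X * T))"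
    by (rule assoc_mult_mat[OF Tt XtJ XT])
  also have "X\<^sup>T * J_mat n * (X * T) = M * T" unfolding M_def by (rule assoc_mult_mat[symmetric, OF XtJ X Tc])
  also have "T\<^sup>T * (M * T) = T\<^sup>T * M * T" by (rule assoc_mult_mat[symmetric, OF Tt M Tc])
  finally show gram: "(X * T)\<^sup>T * J_mat n * (X * T) = T\<^sup>T * (X\<^sup>T * J_mat n * X) * T" by (simp only: M_def)
  have "T\<^sup>T * M * T - J_mat p = T\<^sup>T * M * T - T\<^sup>T * J_mat p * T" by (simp only: sT)
  also have "\<dots> = (T\<^sup>T * M - T\<^sup>T * J_mat p) * T" by (rule minus_mult_distrib_mat[symmetric, OF TtM Tc])
  also have "T\<^sup>T * M - T\<^sup>T * J_mat p = T\<^sup>T * (M - J_mat p)"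
    by (rule mult_minus_distrib_mat[symmetric, OF Tt M J_mat_carrier])
  also have "T\<^sup>T * (M - J_mat p) * T = T\<^sup>T * ((M - J_mat p) * T)" by (rule assoc_mult_mat[OF Tt Q Tc])
  finally have diff: "T\<^sup>T * M * T - J_mat p = T\<^sup>T * ((M - J_mat p) * T)" .
  have "J_mat n * (X * T) * (T\<^sup>T * ((M - J_mat p) * T)) = J_mat n * X * T * (T\<^sup>T * ((M - J_mat p) * T))"
    by (simp only: assoc_mult_mat[OF J_mat_carrier X Tc])
  also have "\<dots> = J_mat n * X * (T * (T\<^sup>T * ((M - J_mat p) * T)))"
    by (rule assoc_mult_mat[OF JX Tc mult_carrier_mat[OF Tt QT]])
  also have "T * (T\<^sup>T * ((M - J_mat p) * T)) = T * T\<^sup>T * ((M - J_mat p) * T)"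
    by (rule assoc_mult_mat[symmetric, OF Tc Tt QT])
  also have "\<dots> = (M - J_mat p) * T"
    unfolding OrSp_transpose(2)[OF T] by (rule left_mult_one_mat[OF QT])
  also have "J_mat n * X * ((M - J_mat p) * T) = J_mat n * X * (M - J_mat p) * T"
    by (rule assoc_mult_mat[symmetric, OF JX Q Tc])
  finally have "\<beta> \<cdot>\<^sub>m (J_mat n * (X * T) * (T\<^sup>T * ((M - J_mat p) * T))) = A * X * T"
    unfolding crit M_def[symmetric] by (simp only: mult_smult_assoc_mat[OF mult_carrier_mat[OF JX Q] Tc])
  then show "A * (X * T) = \<beta> \<cdot>\<^sub>m (J_mat n * (X * T) * ((X * T)\<^sup>T * J_mat n * (X * T) - J_mat p))"
    unfolding gram M_def[symmetric] diff by (simp only: assoc_mult_mat[OF A X Tc])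
qed

text \<open>
The matrix \<open>N = - J M\<close> is symmetric and commutes with \<open>J\<close>, since \<open>M = X\<^sup>T J X\<close> is skew and commutes
with \<open>J\<close>. Diagonalizing it makes \<open>Y = X T\<close> a scaled frame. Its pairs \<open>i \<ge> q\<close> vanish, so \<open>Y\<close> can be
recovered from the first \<open>q\<close> normalized pairs, which form \<open>S\<close>.
\<close>

lemma stationary_imp_frames:
  assumes A: "A \<in> carrier_mat (2 * n) (2 * n)" and pd: "pos_def_mat A" and \<beta>: "0 < \<beta>"
    and X: "X \<in> carrier_mat (2 * n) (2 * p)"
    and crit: "A * X = \<beta> \<cdot>\<^sub>m (J_mat n * X * (X\<^sup>T * J_mat n * X - J_mat p))"
  obtains q S d T where "q \<le> p" "symplectic_frame n q S (\<lambda>_. 1)" "eigen_frame n q A S d"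
    "\<And>i. i < q \<Longrightarrow> 0 < d i \<and> d i < \<beta>" "T \<in> OrSp p"
    "X = S * pair_diag q p (\<lambda>i. sqrt (1 - d i / \<beta>)) * T\<^sup>T"
proof -
  define M where "M = X\<^sup>T * J_mat n * X"
  define N where "N = - (J_mat p * M)"
  have sym: "A\<^sup>T = A" using pd by (simp add: pos_def_mat_def)
  have XtJ: "X\<^sup>T * J_mat n \<in> carrier_mat (2 * p) (2 * n)"
    by (rule mult_carrier_mat[OF _ J_mat_carrier]) (use X in simp)
  have M: "M \<in> carrier_mat (2 * p) (2 * p)" unfolding M_def by (rule mult_carrier_mat[OF XtJ X])
  have MT: "M\<^sup>T = - M" unfolding M_def by (rule symplectic_gram_skew[OF X])
  have JM: "J_mat p * M = M * J_mat p"
    unfolding M_def by (rule stationary_gram_commutes_J_mat[OF A sym \<beta> X crit])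
  have JMc: "J_mat p * M \<in> carrier_mat (2 * p) (2 * p)" by (rule mult_carrier_mat[OF J_mat_carrier M])
  have N: "N \<in> carrier_mat (2 * p) (2 * p)" using JMc by (simp add: N_def)
  have NT: "N\<^sup>T = N"
    using M unfolding N_def
    by (simp add: transpose_uminus transpose_mult[OF J_mat_carrier M] transpose_mult[OF M J_mat_carrier] MT transpose_J_mat JM)
  have JN: "J_mat p * N = M"
  proof -
    have "J_mat p * N = - (J_mat p * (J_mat p * M))" using JMc by (simp add: N_def)
    also have "J_mat p * (J_mat p * M) = J_mat p * J_mat p * M"
      by (rule assoc_mult_mat[symmetric, OF J_mat_carrier J_mat_carrier M])
    finally show ?thesis using M by (simp add: J_mat_square)
  qed
  have NJ: "N * J_mat p = M"
  proof -
    have "N * J_mat p = - (M * J_mat p * J_mat p)" using JMc M by (simp add: N_def JM)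
    also have "M * J_mat p * J_mat p = M * (J_mat p * J_mat p)"
      by (rule assoc_mult_mat[OF M J_mat_carrier J_mat_carrier])
    finally show ?thesis using M by (simp add: J_mat_square)
  qed
  obtain T e q where T: "T \<in> OrSp p" and q: "q \<le> p" and e: "\<And>i. i < q \<Longrightarrow> e i \<noteq> 0"
    "\<And>i. q \<le> i \<Longrightarrow> i < p \<Longrightarrow> e i = 0" and diag: "T\<^sup>T * N * T = mat_diag (2 * p) (\<lambda>i. e (i mod p))"
    by (rule orthosymplectic_diagonalization[OF N NT JN[folded NJ]]) (rule that)
  have Tc: "T \<in> carrier_mat (2 * p) (2 * p)" using T by (simp add: OrSp_def)
  have Tt: "T\<^sup>T \<in> carrier_mat (2 * p) (2 * p)" using Tc by simp
  define Y where "Y = X * T"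
  have Y: "Y \<in> carrier_mat (2 * n) (2 * p)" unfolding Y_def by (rule mult_carrier_mat[OF X Tc])
  have fr: "symplectic_frame n p Y e"
  proof -
    have "Y\<^sup>T * J_mat n * Y = T\<^sup>T * (J_mat p * N) * T"
      unfolding Y_def stationary_mult_OrSp(2)[OF A X T crit] M_def[symmetric] JN ..
    also have "T\<^sup>T * (J_mat p * N) = T\<^sup>T * J_mat p * N" by (rule assoc_mult_mat[symmetric, OF Tt J_mat_carrier N])
    also have "\<dots> = J_mat p * (T\<^sup>T * N)"
      unfolding OrSp_commute_J_mat[OF T] by (rule assoc_mult_mat[OF J_mat_carrier Tt N])
    also have "J_mat p * (T\<^sup>T * N) * T = J_mat p * (T\<^sup>T * N * T)"
      by (rule assoc_mult_mat[OF J_mat_carrier mult_carrier_mat[OF Tt N] Tc])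
    finally show ?thesis using Y by (simp add: symplectic_frame_def diag pair_diag_square)
  qed
  define d where "d i = \<beta> * (1 - e i)" for i
  have ev: "eigen_frame n p A Y d"
    unfolding d_def symplectic_frame_stationary_iff[OF A fr, symmetric]
    unfolding Y_def by (rule stationary_mult_OrSp(1)[OF A X T crit])
  have e01: "0 < e i \<and> e i < 1" if "i < q" for i
  proof -
    have "0 < e i * d i" using eigen_frame_pos_def(2)[OF A pd fr ev, of i] e(1)[OF that] that q by simp
    then have "0 < \<beta> * (e i * (1 - e i))" by (simp add: d_def mult_ac)
    then have "0 < e i * (1 - e i)" using \<beta> by (simp add: zero_less_mult_iff)
    then show ?thesis by (auto simp: zero_less_mult_iff)
  qed
  have d: "0 < d i \<and> d i < \<beta>" if "i < q" for i
    using e01[OF that] \<beta> by (simp add: d_def)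
  have ed: "1 - d i / \<beta> = e i" for i using \<beta> by (simp add: d_def)
  define S where "S = Y * pair_diag p q (\<lambda>i. 1 / sqrt (e i))"
  have S: "S \<in> carrier_mat (2 * n) (2 * q)" unfolding S_def by (rule mult_carrier_mat[OF Y pair_diag_carrier])
  have frS: "symplectic_frame n q S (\<lambda>_. 1)"
  proof -
    have nz: "e i \<noteq> 0" "0 \<le> e i" if "i < q" for i using e01[OF that] by auto
    have "pair_diag q q (\<lambda>i. if i < p then e i * (1 / sqrt (e i))\<^sup>2 else 0) = pair_diag q q (\<lambda>_. 1)"
      using q by (intro pair_diag_cong) (simp add: power_divide nz)
    then show ?thesis
      using symplectic_frame_mult_pair_diag[OF fr, of q "\<lambda>i. 1 / sqrt (e i)"]
      by (simp add: symplectic_frame_def S_def)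
  qed
  have evS: "eigen_frame n q A S d" unfolding S_def by (rule eigen_frame_mult_pair_diag[OF A Y ev]) simp
  have "S * pair_diag q p (\<lambda>i. sqrt (1 - d i / \<beta>)) = Y"
  proof -
    have "S * pair_diag q p (\<lambda>i. sqrt (1 - d i / \<beta>)) =
        Y * (pair_diag p q (\<lambda>i. 1 / sqrt (e i)) * pair_diag q p (\<lambda>i. sqrt (1 - d i / \<beta>)))"
      unfolding S_def by (rule assoc_mult_mat[OF Y pair_diag_carrier pair_diag_carrier])
    also have "pair_diag p q (\<lambda>i. 1 / sqrt (e i)) * pair_diag q p (\<lambda>i. sqrt (1 - d i / \<beta>)) =
        pair_diag p p (\<lambda>i. if i < q then 1 else 0)"
      unfolding pair_diag_mult ed using e01 by (intro pair_diag_cong) (simp add: less_imp_neq[symmetric])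
    also have "Y * \<dots> = Y"
    proof (rule eq_matI)
      fix r j assume "r < dim_row Y" "j < dim_col Y"
      then have r: "r < 2 * n" and j: "j < 2 * p" using Y by auto
      have vanish: "Y $$ (r,i) = 0 \<and> Y $$ (r,p + i) = 0" if "q \<le> i" "i < p" for i
      proof -
        have "col Y i = 0\<^sub>v (2 * n) \<and> col Y (p + i) = 0\<^sub>v (2 * n)"
          by (rule eigen_frame_pos_def(1)[OF A pd fr ev that(2) e(2)[OF that]])
        then have "col Y i $ r = 0" "col Y (p + i) $ r = 0" using r by simp_all
        then show ?thesis using r that Y by simp
      qed
      show "(Y * pair_diag p p (\<lambda>i. if i < q then 1 else 0)) $$ (r,j) = Y $$ (r,j)"
      proof (cases "j < p")
        case True
        then show ?thesis using mult_pair_diag_index(1)[OF Y r True] vanish[of j] by simp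
      next
        case False
        define i where "i = j - p"
        have i: "j = p + i" "i < p" using False j by (auto simp: i_def)
        then show ?thesis using mult_pair_diag_index(2)[OF Y r i(2)] vanish[of i] by simp
      qed
    qed (use Y in auto)
    finally show ?thesis .
  qed
  moreover have "X = Y * T\<^sup>T"
    unfolding Y_def assoc_mult_mat[OF X Tc Tt] OrSp_transpose(2)[OF T] using X by simp
  ultimately show ?thesis using that[OF q frS evS d T] by simp
qed

text \<open>
The columns of \<open>X T\<close> form a frame with scaling factors \<open>e i = 1 - d i / \<beta>\<close>, that is,
\<open>\<beta> (1 - e i) = d i\<close>, for \<open>i < q\<close>. The remaining pairs are zero, so there \<open>e i = 0\<close>, and the
eigenvector equations hold for every eigenvalue, in particular for \<open>\<beta>\<close>.
\<close>

lemma frames_imp_stationary: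
  assumes A: "A \<in> carrier_mat (2 * n) (2 * n)" and \<beta>: "0 < \<beta>"
    and q: "q \<le> p" and frS: "symplectic_frame n q S (\<lambda>_. 1)" and evS: "eigen_frame n q A S d"
    and d: "\<And>i. i < q \<Longrightarrow> d i < \<beta>" and T: "T \<in> OrSp p"
    and X: "X = S * pair_diag q p (\<lambda>i. sqrt (1 - d i / \<beta>)) * T\<^sup>T"
  shows "A * X = \<beta> \<cdot>\<^sub>m (J_mat n * X * (X\<^sup>T * J_mat n * X - J_mat p))"
proof -
  let ?Y = "S * pair_diag q p (\<lambda>i. sqrt (1 - d i / \<beta>))"
  define e where "e i = (if i < q then 1 * (sqrt (1 - d i / \<beta>))\<^sup>2 else 0)" for i
  have S: "S \<in> carrier_mat (2 * n) (2 * q)" using frS by (simp add: symplectic_frame_def)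
  have Y: "?Y \<in> carrier_mat (2 * n) (2 * p)" by (rule mult_carrier_mat[OF S pair_diag_carrier])
  have fr: "symplectic_frame n p ?Y e"
    unfolding e_def by (rule symplectic_frame_mult_pair_diag[OF frS])
  have "eigen_frame n p A ?Y (\<lambda>i. \<beta> * (1 - e i))"
  proof (rule eigen_frame_mult_pair_diag[OF A S evS])
    fix i assume i: "i < q"
    have "0 \<le> 1 - d i / \<beta>" using d[OF i] \<beta> by simp
    then have "e i = 1 - d i / \<beta>" using i by (simp add: e_def)
    then show "\<beta> * (1 - e i) = d i" using \<beta> by simp
  qed
  then have "A * ?Y = \<beta> \<cdot>\<^sub>m (J_mat n * ?Y * (?Y\<^sup>T * J_mat n * ?Y - J_mat p))"
    using symplectic_frame_stationary_iff[OF A fr] by blast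
  then show ?thesis
    unfolding X by (rule stationary_mult_OrSp(1)[OF A Y OrSp_transpose(1)[OF T]])
qed

theorem proposition3:
  fixes n p :: nat and A X :: "real mat" and \<beta> :: real
  assumes "0 < n" and "0 < p" and "p \<le> n"
    and "A \<in> carrier_mat (2 * n) (2 * n)" and "pos_def_mat A"
    and "0 < \<beta>"
    and "X \<in> carrier_mat (2 * n) (2 * p)"
  shows "has_mat_gradient (f_beta n p A \<beta>) (0\<^sub>m (2 * n) (2 * p)) X \<longleftrightarrow>
    (\<exists>q S1 S2 D T.
       q \<le> p \<and>
       S1 \<in> carrier_mat (2 * n) q \<and> S2 \<in> carrier_mat (2 * n) q \<and>
       S1 @\<^sub>c S2 \<in> Sp q n \<and>
       D \<in> carrier_mat q q \<and> diagonal_mat D \<and>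
       pos_def_mat D \<and> pos_def_mat (\<beta> \<cdot>\<^sub>m 1\<^sub>m q - D) \<and>
       symplectic_eigenvector_pairs n q A (S1 @\<^sub>c S2) D \<and>
       (S1 @\<^sub>c S2)\<^sup>T * A * (S1 @\<^sub>c S2) = diag_block_mat [D, D] \<and>
       T \<in> OrSp p \<and>
       X = (S1 * mat_sqrt (1\<^sub>m q - (1 / \<beta>) \<cdot>\<^sub>m D) @\<^sub>c 0\<^sub>m (2 * n) (p - q) @\<^sub>c
            S2 * mat_sqrt (1\<^sub>m q - (1 / \<beta>) \<cdot>\<^sub>m D) @\<^sub>c 0\<^sub>m (2 * n) (p - q)) * T\<^sup>T)"
    (is "_ \<longleftrightarrow> ?decomposed")
proof -
  note A = assms(4) and pd = assms(5) and \<beta> = assms(6) and X = assms(7)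
  have sym: "A\<^sup>T = A" using pd by (simp add: pos_def_mat_def)
  have minus_diag: "\<beta> \<cdot>\<^sub>m 1\<^sub>m q - mat_diag q d = mat_diag q (\<lambda>i. \<beta> - d i)" for q d
    by (intro eq_matI) (auto simp: mat_diag_def)
  have sqrt_diag: "mat_sqrt (1\<^sub>m q - (1 / \<beta>) \<cdot>\<^sub>m mat_diag q d) = mat_diag q (\<lambda>i. sqrt (1 - d i / \<beta>))"
    if "\<And>i. i < q \<Longrightarrow> d i < \<beta>" for q d
  proof -
    have "1\<^sub>m q - (1 / \<beta>) \<cdot>\<^sub>m mat_diag q d = mat_diag q (\<lambda>i. 1 - d i / \<beta>)"
      by (intro eq_matI) (auto simp: mat_diag_def)
    then show ?thesis using mat_sqrt_mat_diag[of q "\<lambda>i. 1 - d i / \<beta>"] that \<beta> by simp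
  qed
  show ?thesis
    unfolding f_beta_stationary_iff[OF A sym X \<beta>]
  proof
    assume "A * X = \<beta> \<cdot>\<^sub>m (J_mat n * X * (X\<^sup>T * J_mat n * X - J_mat p))"
    then obtain q S d T where q: "q \<le> p" and fr: "symplectic_frame n q S (\<lambda>_. 1)"
      and ev: "eigen_frame n q A S d" and d: "\<And>i. i < q \<Longrightarrow> 0 < d i \<and> d i < \<beta>"
      and T: "T \<in> OrSp p" and XS: "X = S * pair_diag q p (\<lambda>i. sqrt (1 - d i / \<beta>)) * T\<^sup>T"
      using stationary_imp_frames[OF A pd \<beta> X] by blast
    have S: "S \<in> carrier_mat (2 * n) (2 * q)" using fr by (simp add: symplectic_frame_def)
    obtain S1 S2 where S12: "S1 \<in> carrier_mat (2 * n) q" "S2 \<in> carrier_mat (2 * n) q" "S = S1 @\<^sub>c S2"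
      using append_cols_split[OF S] by blast
    have Sp: "S \<in> Sp q n" using fr by (simp add: Sp_iff_symplectic_frame)
    have "eigen_frame n q A S (\<lambda>i. mat_diag q d $$ (i,i))"
      using ev unfolding eigen_frame_iff_cols[OF A S] by (simp add: mat_diag_def)
    then have "symplectic_eigenvector_pairs n q A S (mat_diag q d)"
      using Sp by (simp add: symplectic_eigenvector_pairs_iff[OF A])
    moreover have "S\<^sup>T * A * S = diag_block_mat [mat_diag q d, mat_diag q d]"
      unfolding diag_block_mat_eq_pair_diag using eigen_frame_gram[OF A fr ev] by simp
    moreover have "diagonal_mat (mat_diag q d)" by (simp add: diagonal_mat_def mat_diag_def)
    moreover have "pos_def_mat (mat_diag q d)" "pos_def_mat (\<beta> \<cdot>\<^sub>m 1\<^sub>m q - mat_diag q d)"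
      using d by (simp_all add: minus_diag pos_def_mat_diag_iff)
    moreover have "X = (S1 * mat_sqrt (1\<^sub>m q - (1 / \<beta>) \<cdot>\<^sub>m mat_diag q d) @\<^sub>c 0\<^sub>m (2 * n) (p - q) @\<^sub>c
            S2 * mat_sqrt (1\<^sub>m q - (1 / \<beta>) \<cdot>\<^sub>m mat_diag q d) @\<^sub>c 0\<^sub>m (2 * n) (p - q)) * T\<^sup>T"
      using d by (simp only: XS S12(3) append_cols_mult_pair_diag[OF S12(1,2) q] sqrt_diag)
    ultimately show ?decomposed
      using q S12 Sp T mat_diag_dim by blast
  next
    assume ?decomposed
    then obtain q S1 S2 D T where q: "q \<le> p"
      and S12: "S1 \<in> carrier_mat (2 * n) q" "S2 \<in> carrier_mat (2 * n) q"
      and D: "D \<in> carrier_mat q q" "diagonal_mat D" and D\<beta>: "pos_def_mat (\<beta> \<cdot>\<^sub>m 1\<^sub>m q - D)"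
      and sep: "symplectic_eigenvector_pairs n q A (S1 @\<^sub>c S2) D" and T: "T \<in> OrSp p"
      and XS: "X = (S1 * mat_sqrt (1\<^sub>m q - (1 / \<beta>) \<cdot>\<^sub>m D) @\<^sub>c 0\<^sub>m (2 * n) (p - q) @\<^sub>c
            S2 * mat_sqrt (1\<^sub>m q - (1 / \<beta>) \<cdot>\<^sub>m D) @\<^sub>c 0\<^sub>m (2 * n) (p - q)) * T\<^sup>T"
      by blast
    define d where "d i = D $$ (i,i)" for i
    have Dd: "D = mat_diag q d" unfolding d_def by (rule diagonal_mat_eq_mat_diag[OF D])
    have d: "d i < \<beta>" if "i < q" for i
      using D\<beta> that unfolding Dd minus_diag pos_def_mat_diag_iff by simp
    have fr: "symplectic_frame n q (S1 @\<^sub>c S2) (\<lambda>_. 1)" and ev: "eigen_frame n q A (S1 @\<^sub>c S2) d"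
      using sep unfolding symplectic_eigenvector_pairs_iff[OF A] Sp_iff_symplectic_frame d_def by auto
    have "X = (S1 @\<^sub>c S2) * pair_diag q p (\<lambda>i. sqrt (1 - d i / \<beta>)) * T\<^sup>T"
      by (simp only: append_cols_mult_pair_diag[OF S12 q] XS Dd sqrt_diag[OF d])
    then show "A * X = \<beta> \<cdot>\<^sub>m (J_mat n * X * (X\<^sup>T * J_mat n * X - J_mat p))"
      using frames_imp_stationary[OF A \<beta> q fr ev _ T] d by blast
  qed
qed

end
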